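(* Let $\mathcal{A}$ be an operator ideal, let $\lambda \geq 1$, and let $X$ be a real Banach space. The following statements are equivalent. (a) $X$ has the Lip-$\mathcal{A}$-$\lambda$-BAP, i.e. $\mathrm{Id}_X \in \overline{\mathrm{Lip}_{\mathcal{A}}^{\lambda}(X,X)}^{\tau_c}$. (b) $\beta_X \in \overline{\mathrm{Lip}_{\mathcal{A}}^{\lambda}(\mathfrak{F}(X),X)}^{\tau_c}$. (c) $\beta_X \in \overline{\mathcal{A}^{\lambda}(\mathfrak{F}(X),X)}^{\tau_c}$. (d) $\iota_X \in \overline{\mathcal{A}_c^{\lambda}(X^*,\mathrm{Lip}_0(X))}^{w^*}$, where $w^*$ is the weak-star topology on $\mathcal{L}(X^*,\mathrm{Lip}_0(X))$ with respect to $X^*\widehat{\otimes}_\pi \mathfrak{F}(X)$.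
   Context: All Banach spaces are real. For Banach spaces $X,Y$, $\mathcal{L}(X,Y)$ is the space of bounded linear operators, and $\mathrm{Lip}_0(X,Y)$ is the Banach space of Lipschitz maps $f:X\to Y$ with $f(0)=0$, with norm $\|f\|_{\mathrm{Lip}}=\sup_{x\neq y}\|f(x)-f(y)\|/\|x-y\|$; $\mathrm{Lip}_0(X)=\mathrm{Lip}_0(X,\mathbb{R})$. For $x\in X$ let $\delta_x\in \mathrm{Lip}_0(X)^*$, $\delta_x(f)=f(x)$. The Lipschitz-free space is $\mathfrak{F}(X)=\overline{\mathrm{span}}\{\delta_x: x\in X\}\subseteq \mathrm{Lip}_0(X)^*$, and $\delta_X:X\to\mathfrak{F}(X)$, $\delta_X(x)=\delta_x$, is a (nonlinear) isometry. For each $f\in\mathrm{Lip}_0(X,Y)$ there is a unique $L_f\in\mathcal{L}(\mathfrak{F}(X),Y)$ with $L_f\delta_X=f$; $\|L_f\|=\|f\|_{\mathrm{Lip}}$, and $f\mapsto L_f$ is an isometric isomorphism of $\mathrm{Lip}_0(X,Y)$ onto $\mathcal{L}(\mathfrak{F}(X),Y)$. In particular $\mathrm{Lip}_0(X)$ is identified with $\mathfrak{F}(X)^*$. The map $\beta_X:\mathfrak{F}(X)\to X$ is the bounded linear quotient map determined by $x^*(\beta_X(\mu))=\langle x^*,\mu\rangle$ for all $x^*\in X^*\subseteq\mathrm{Lip}_0(X)$; so $\beta_X(\delta_x)=x$. The map $\iota_X: X^*\to\mathrm{Lip}_0(X)$ is the canonical embedding (it equals $\beta_X^*$ under the identification above).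 Operator ideals are (linear) operator ideals in the usual sense. For an operator ideal $\mathcal{A}$ and $\lambda\ge 1$: $\mathcal{A}^\lambda(X,Y)=\{T\in\mathcal{A}(X,Y):\|T\|\le\lambda\}$; $\mathrm{Lip}_{\mathcal{A}}(X,Y)=\{f\in\mathrm{Lip}_0(X,Y): L_f\in\mathcal{A}(\mathfrak{F}(X),Y)\}$; $\mathrm{Lip}_{\mathcal{A}}^\lambda(X,Y)=\{f\in\mathrm{Lip}_{\mathcal{A}}(X,Y):\|f\|_{\mathrm{Lip}}\le\lambda\}$; $\mathcal{A}_c^\lambda(Y^*,X^* )=\{T^*: T\in\mathcal{A}^\lambda(X,Y)\}$. Thus $\mathcal{A}_c^\lambda(X^*,\mathrm{Lip}_0(X))=\{T^*:T\in\mathcal{A}^\lambda(\mathfrak{F}(X),X)\}$. $\tau_c$ denotes the compact-open topology (uniform convergence on compact subsets of the domain). The weak-star topology on $\mathcal{L}(X^*,\mathrm{Lip}_0(X))=\mathcal{L}(X^*,\mathfrak{F}(X)^* )$ is the one coming from the identification with $(X^*\widehat{\otimes}_\pi\mathfrak{F}(X))^*$, where $\widehat{\otimes}_\pi$ is the projective tensor product and $\langle x^*\otimes\mu,T\rangle=\langle \mu,Tx^*\rangle$. *)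

theory Defs
  imports "HOL-Analysis.Analysis"
begin

section \<open>The Hahn--Banach theorem: norming functionals\<close>

definition sublinear :: "('a::real_vector \<Rightarrow> real) \<Rightarrow> bool" where
  "sublinear q \<longleftrightarrow> (\<forall>x y. q (x + y) \<le> q x + q y) \<and> (\<forall>t x. 0 < t \<longrightarrow> q (t *\<^sub>R x) = t * q x)"

lemma sublinear_add: "sublinear q \<Longrightarrow> q (x + y) \<le> q x + q y"
  and sublinear_scale: "sublinear q \<Longrightarrow> 0 < t \<Longrightarrow> q (t *\<^sub>R x) = t * q x"
  by (auto simp: sublinear_def)

lemma sublinear_zero: "sublinear q \<Longrightarrow> q 0 = 0"
  using sublinear_scale[of q 2 0] by simp

lemma sublinear_lower: "sublinear q \<Longrightarrow> - q (- x) \<le> q x"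
  using sublinear_add[of q x "- x"] sublinear_zero[of q] by simp

lemma sublinear_scale': "sublinear q \<Longrightarrow> 0 \<le> t \<Longrightarrow> q (t *\<^sub>R x) = t * q x"
  by (cases "t = 0") (auto simp: sublinear_zero sublinear_scale)

lemma sublinear_shrink:
  fixes q :: "'a::real_vector \<Rightarrow> real"
  assumes q: "sublinear q"
  obtains r where "sublinear r" "\<And>x. r x \<le> q x" "\<And>x. r x \<le> q (x + y) - q y"
proof -
  define S where "S x = (\<lambda>t. q (x + t *\<^sub>R y) - t * q y) ` {0..}" for x
  define r where "r x = Inf (S x)" for x
  have ne: "S x \<noteq> {}" for x by (auto simp: S_def)
  have lb: "- q (- x) \<le> s" if s: "s \<in> S x" for x s
  proof -
    obtain t where t: "0 \<le> t" "s = q (x + t *\<^sub>R y) - t * q y"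
      using s by (auto simp: S_def)
    have "q (t *\<^sub>R y) \<le> q (x + t *\<^sub>R y) + q (- x)"
      using sublinear_add[OF q, of "x + t *\<^sub>R y" "- x"] by simp
    with t show ?thesis by (simp add: sublinear_scale'[OF q])
  qed
  have bdd: "bdd_below (S x)" for x using lb by (rule bdd_belowI)
  have le: "r x \<le> q (x + t *\<^sub>R y) - t * q y" if "0 \<le> t" for x t
    unfolding r_def by (rule cInf_lower[OF _ bdd]) (use that in \<open>auto simp: S_def\<close>)
  have add: "r (x + z) \<le> r x + r z" for x z
  proof -
    have "r (x + z) - b \<le> r x" if b: "b \<in> S z" for b
      unfolding r_def[of x]
    proof (rule cInf_greatest[OF ne])
      fix a assume a: "a \<in> S x"
      obtain t where t: "0 \<le> t" "a = q (x + t *\<^sub>R y) - t * q y" using a by (auto simp: S_def)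
      obtain u where u: "0 \<le> u" "b = q (z + u *\<^sub>R y) - u * q y" using b by (auto simp: S_def)
      have "r (x + z) \<le> q ((x + z) + (t + u) *\<^sub>R y) - (t + u) * q y"
        using t u by (intro le) auto
      also have "(x + z) + (t + u) *\<^sub>R y = (x + t *\<^sub>R y) + (z + u *\<^sub>R y)"
        by (simp add: algebra_simps)
      finally show "r (x + z) - b \<le> a"
        using sublinear_add[OF q, of "x + t *\<^sub>R y" "z + u *\<^sub>R y"] t u
        by (simp add: algebra_simps)
    qed
    then have "r (x + z) - r x \<le> b" if "b \<in> S z" for b
      using that by (simp add: algebra_simps)
    then have "r (x + z) - r x \<le> r z"
      unfolding r_def[of z] by (intro cInf_greatest[OF ne])
    then show ?thesis by simp
  qed
  have sc1: "r (c *\<^sub>R x) \<le> c * r x" if c: "0 < c" for c x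
  proof -
    have "r (c *\<^sub>R x) / c \<le> r x"
      unfolding r_def[of x]
    proof (rule cInf_greatest[OF ne])
      fix a assume a: "a \<in> S x"
      obtain t where t: "0 \<le> t" "a = q (x + t *\<^sub>R y) - t * q y" using a by (auto simp: S_def)
      have "r (c *\<^sub>R x) \<le> q (c *\<^sub>R x + (c * t) *\<^sub>R y) - (c * t) * q y"
        using c t by (intro le) auto
      also have "c *\<^sub>R x + (c * t) *\<^sub>R y = c *\<^sub>R (x + t *\<^sub>R y)" by (simp add: algebra_simps)
      finally have "r (c *\<^sub>R x) \<le> c * a"
        unfolding sublinear_scale[OF q c] t(2) by (simp add: algebra_simps)
      then show "r (c *\<^sub>R x) / c \<le> a" using c by (simp add: field_simps)
    qed
    then show ?thesis using c by (simp add: field_simps)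
  qed
  have sc: "r (c *\<^sub>R x) = c * r x" if c: "0 < c" for c x
  proof (rule antisym[OF sc1[OF c]])
    have "r (inverse c *\<^sub>R (c *\<^sub>R x)) \<le> inverse c * r (c *\<^sub>R x)" using c by (intro sc1) auto
    then show "c * r x \<le> r (c *\<^sub>R x)" using c by (simp add: field_simps)
  qed
  show thesis
  proof (rule that[of r])
    show "sublinear r" using add sc by (auto simp: sublinear_def)
    show "r x \<le> q x" for x using le[of 0 x] by simp
    show "r x \<le> q (x + y) - q y" for x using le[of 1 x] by simp
  qed
qed

lemma sublinear_minimal:
  fixes p :: "'a::real_vector \<Rightarrow> real"
  assumes p: "sublinear p"
  obtains f where "linear f" "\<And>x. f x \<le> p x"
proof -
  define A where "A = {q. sublinear q \<and> (\<forall>x. q x \<le> p x)}"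
  define P where "P = (\<lambda>q r :: 'a \<Rightarrow> real. \<forall>x. r x \<le> q x)"
  have "\<exists>m\<in>A. \<forall>a\<in>A. P m a \<longrightarrow> a = m"
  proof (rule predicate_Zorn)
    show "partial_order_on A (relation_of P A)"
      by (rule partial_order_on_relation_ofI)
        (auto simp: P_def fun_eq_iff intro: order_trans antisym)
    fix C assume C: "C \<in> Chains (relation_of P A)"
    have CA: "C \<subseteq> A" using C by (auto simp: Chains_def relation_of_def)
    have tot: "P q r \<or> P r q" if "q \<in> C" "r \<in> C" for q r
      using C that by (auto simp: Chains_def relation_of_def)
    show "\<exists>u\<in>A. \<forall>a\<in>C. P a u"
    proof (cases "C = {}")
      case True
      then show ?thesis using p by (auto simp: A_def)
    next
      case False
      define u where "u x = (INF q\<in>C. q x)" for x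
      have sub: "sublinear q" and le: "q x \<le> p x" if "q \<in> C" for q x
        using that CA by (auto simp: A_def)
      have bdd: "bdd_below ((\<lambda>q. q x) ` C)" for x
        using sublinear_lower[OF sub] le
        by (intro bdd_belowI2[of _ "- p (- x)"]) (meson neg_le_iff_le order_trans)
      have low: "u x \<le> q x" if "q \<in> C" for x q
        unfolding u_def by (rule cINF_lower[OF bdd that])
      have great: "b \<le> u x" if "\<And>q. q \<in> C \<Longrightarrow> b \<le> q x" for b x
        unfolding u_def using False that by (intro cINF_greatest) auto
      have add: "u (x + y) \<le> u x + u y" for x y
      proof -
        have *: "u (x + y) \<le> q x + r y" if q: "q \<in> C" and r: "r \<in> C" for q r
        proof -
          have "u (x + y) \<le> q x + q y" "u (x + y) \<le> r x + r y"
            using low[OF q, of "x + y"] sublinear_add[OF sub[OF q], of x y]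
              low[OF r, of "x + y"] sublinear_add[OF sub[OF r], of x y] by linarith+
          moreover have "q y \<le> r y \<or> r x \<le> q x" using tot[OF q r] by (auto simp: P_def)
          ultimately show ?thesis by auto
        qed
        have "u (x + y) - r y \<le> u x" if "r \<in> C" for r
          using *[OF _ that] by (intro great) (simp add: algebra_simps)
        then have "u (x + y) - u x \<le> u y"
          by (intro great) (simp add: algebra_simps)
        then show ?thesis by simp
      qed
      have sc1: "u (c *\<^sub>R x) \<le> c * u x" if c: "0 < c" for c x
      proof -
        have "u (c *\<^sub>R x) / c \<le> u x"
        proof (rule great)
          fix q assume q: "q \<in> C"
          show "u (c *\<^sub>R x) / c \<le> q x"
            using low[OF q, of "c *\<^sub>R x"] c by (simp add: sublinear_scale[OF sub[OF q]] field_simps)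
        qed
        then show ?thesis using c by (simp add: field_simps)
      qed
      have sc: "u (c *\<^sub>R x) = c * u x" if c: "0 < c" for c x
      proof (rule antisym[OF sc1[OF c]])
        have "u (inverse c *\<^sub>R (c *\<^sub>R x)) \<le> inverse c * u (c *\<^sub>R x)" using c by (intro sc1) auto
        then show "c * u x \<le> u (c *\<^sub>R x)" using c by (simp add: field_simps)
      qed
      have "u x \<le> p x" for x
        using False low le by (meson all_not_in_conv order_trans)
      then have "u \<in> A" using add sc by (auto simp: A_def sublinear_def)
      then show ?thesis using low by (auto simp: P_def)
    qed
  qed
  then obtain m where m: "sublinear m" "\<And>x. m x \<le> p x"
    and min: "\<And>a. sublinear a \<Longrightarrow> (\<And>x. a x \<le> p x) \<Longrightarrow> (\<And>x. a x \<le> m x) \<Longrightarrow> a = m"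
    by (auto simp: A_def P_def)
  have add: "m (x + y) = m x + m y" for x y
  proof -
    obtain r where r: "sublinear r" "\<And>x. r x \<le> m x" "\<And>x. r x \<le> m (x + y) - m y"
      using sublinear_shrink[OF m(1)] by metis
    have "r = m" using min[OF r(1)] r(2) m(2) order_trans by blast
    then show ?thesis using r(3)[of x] sublinear_add[OF m(1), of x y] by simp
  qed
  have neg: "m (- x) = - m x" for x
    using add[of x "- x"] sublinear_zero[OF m(1)] by simp
  have "m (c *\<^sub>R x) = c * m x" for c x
    using sublinear_scale'[OF m(1), of c x] sublinear_scale'[OF m(1), of "- c" x] neg[of "c *\<^sub>R x"]
    by (cases "0 \<le> c") auto
  then have "linear m" using add by (intro linearI) auto
  then show thesis using m(2) that by blast
qed

lemma norming_functional:
  fixes x :: "'a::real_normed_vector"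
  obtains \<phi> :: "'a \<Rightarrow>\<^sub>L real" where "norm \<phi> \<le> 1" "\<phi> x = norm x"
proof -
  have n: "sublinear (norm :: 'a \<Rightarrow> real)"
    by (auto simp: sublinear_def norm_triangle_ineq)
  obtain r where r: "sublinear r" "\<And>z. r z \<le> norm z" "\<And>z. r z \<le> norm (z + x) - norm x"
    using sublinear_shrink[OF n] by metis
  obtain f where f: "linear f" "\<And>z. f z \<le> r z" using sublinear_minimal[OF r(1)] by metis
  have up: "f z \<le> norm z" for z using f(2)[of z] r(2)[of z] by simp
  have ab: "norm (f z) \<le> norm z * 1" for z
    using up[of z] up[of "- z"] by (simp add: linear_neg[OF f(1)])
  have bl: "bounded_linear f"
    using f(1) ab by (intro bounded_linear_intro[where K = 1])
      (auto simp: linear_add linear_scale)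
  have "f (- x) \<le> - norm x" using f(2)[of "- x"] r(3)[of "- x"] by simp
  then have "f x = norm x" using up[of x] by (simp add: linear_neg[OF f(1)])
  moreover have "norm (Blinfun f) \<le> 1"
    using ab by (intro norm_blinfun_bound) (auto simp: bounded_linear_Blinfun_apply[OF bl])
  ultimately show thesis
    using that[of "Blinfun f"] by (simp add: bounded_linear_Blinfun_apply[OF bl])
qed

lemma functionals_separate:
  fixes x y :: "'a::real_normed_vector"
  assumes "\<And>\<phi> :: 'a \<Rightarrow>\<^sub>L real. \<phi> x = \<phi> y"
  shows "x = y"
proof -
  obtain \<phi> :: "'a \<Rightarrow>\<^sub>L real" where "\<phi> (x - y) = norm (x - y)"
    using norming_functional by metis
  then show ?thesis using assms[of \<phi>] by (simp add: blinfun.diff_right)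
qed

section \<open>Lipschitz maps vanishing at the origin\<close>

typedef (overloaded) ('a::real_normed_vector, 'b::real_normed_vector) lip0 =
  "{f :: 'a \<Rightarrow> 'b. f 0 = 0 \<and> (\<exists>C. C-lipschitz_on UNIV f)}"
  morphisms lip0_apply Lip0
  by (rule exI[of _ "\<lambda>_. 0"]) (auto simp: lipschitz_on_def)

setup_lifting type_definition_lip0

definition lip_const :: "('a::real_normed_vector \<Rightarrow> 'b::real_normed_vector) \<Rightarrow> real" where
  \<comment> \<open>pairs with \<open>x = y\<close> contribute \<open>0 / 0 = 0\<close>, so that the supremum is also right on the zero space\<close>
  "lip_const f = (SUP (x, y). norm (f x - f y) / norm (x - y))"

lemma lip_const_bdd:
  assumes "C-lipschitz_on UNIV f"
  shows "bdd_above (range (\<lambda>(x, y). norm (f x - f y) / norm (x - y)))"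
proof (rule bdd_aboveI2)
  fix z :: "'a \<times> 'a"
  show "(case z of (x, y) \<Rightarrow> norm (f x - f y) / norm (x - y)) \<le> C"
    using lipschitz_on_normD[OF assms, of "fst z" "snd z"] lipschitz_on_nonneg[OF assms]
    by (cases "norm (fst z - snd z) = 0") (auto simp: field_simps split_beta)
qed

lemma lip_const_le:
  assumes "\<And>x y. norm (f x - f y) \<le> C * norm (x - y)" "0 \<le> C"
  shows "lip_const f \<le> C"
  unfolding lip_const_def
proof (rule cSUP_least)
  fix z :: "'a \<times> 'a"
  show "(case z of (x, y) \<Rightarrow> norm (f x - f y) / norm (x - y)) \<le> C"
    using assms by (cases "norm (fst z - snd z) = 0") (auto simp: field_simps split_beta)
qed simp

lemma lip_const_bound:
  assumes "C-lipschitz_on UNIV f"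
  shows "norm (f x - f y) \<le> lip_const f * norm (x - y)"
proof (cases "x = y")
  case False
  have "norm (f x - f y) / norm (x - y) \<le> lip_const f"
    unfolding lip_const_def using cSUP_upper[OF _ lip_const_bdd[OF assms], of "(x, y)"] by simp
  then show ?thesis using False by (simp add: field_simps)
qed simp

lemma lip_const_nonneg: "C-lipschitz_on UNIV f \<Longrightarrow> 0 \<le> lip_const f"
  unfolding lip_const_def using cSUP_upper[OF _ lip_const_bdd, of "(0, 0)" C f] by simp

instantiation lip0 :: (real_normed_vector, real_normed_vector) real_normed_vector
begin

lift_definition norm_lip0 :: "('a, 'b) lip0 \<Rightarrow> real" is lip_const .

lift_definition zero_lip0 :: "('a, 'b) lip0" is "\<lambda>_. 0"
  by (auto simp: lipschitz_on_def)

lift_definition plus_lip0 :: "('a, 'b) lip0 \<Rightarrow> ('a, 'b) lip0 \<Rightarrow> ('a, 'b) lip0"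
  is "\<lambda>f g x. f x + g x"
  by (auto intro: lipschitz_on_add)

lift_definition minus_lip0 :: "('a, 'b) lip0 \<Rightarrow> ('a, 'b) lip0 \<Rightarrow> ('a, 'b) lip0"
  is "\<lambda>f g x. f x - g x"
  by (auto intro: lipschitz_on_diff)

lift_definition uminus_lip0 :: "('a, 'b) lip0 \<Rightarrow> ('a, 'b) lip0" is "\<lambda>f x. - f x"
  by (auto intro: lipschitz_on_minus)

lift_definition scaleR_lip0 :: "real \<Rightarrow> ('a, 'b) lip0 \<Rightarrow> ('a, 'b) lip0" is "\<lambda>r f x. r *\<^sub>R f x"
  by (auto intro: lipschitz_on_cmult)

definition dist_lip0 :: "('a, 'b) lip0 \<Rightarrow> ('a, 'b) lip0 \<Rightarrow> real"
  where "dist_lip0 f g = norm (f - g)"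

definition [code del]:
  "(uniformity :: (('a, 'b) lip0 \<times> ('a, 'b) lip0) filter) = (INF e\<in>{0<..}. principal {(x, y). dist x y < e})"

definition open_lip0 :: "('a, 'b) lip0 set \<Rightarrow> bool"
  where [code del]: "open_lip0 S = (\<forall>x\<in>S. \<forall>\<^sub>F (x', y) in uniformity. x' = x \<longrightarrow> y \<in> S)"

definition sgn_lip0 :: "('a, 'b) lip0 \<Rightarrow> ('a, 'b) lip0"
  where "sgn_lip0 f = inverse (norm f) *\<^sub>R f"

instance
proof
  fix f g h :: "('a, 'b) lip0" and a b :: real
  show "f + g + h = f + (g + h)" "f + g = g + f" "0 + f = f" "- f + f = 0" "f - g = f + - g"
    "a *\<^sub>R (f + g) = a *\<^sub>R f + a *\<^sub>R g" "(a + b) *\<^sub>R f = a *\<^sub>R f + b *\<^sub>R f"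
    "a *\<^sub>R b *\<^sub>R f = (a * b) *\<^sub>R f" "1 *\<^sub>R f = f"
    by (transfer; simp add: algebra_simps)+
  show "dist f g = norm (f - g)" by (fact dist_lip0_def)
  show "sgn f = inverse (norm f) *\<^sub>R f" by (fact sgn_lip0_def)
  show "uniformity = (INF e\<in>{0<..}. principal {(x, y :: ('a, 'b) lip0). dist x y < e})"
    by (fact uniformity_lip0_def)
  show "open U \<longleftrightarrow> (\<forall>x\<in>U. \<forall>\<^sub>F (x', y) in uniformity. x' = x \<longrightarrow> y \<in> U)"
    for U :: "('a, 'b) lip0 set"
    by (fact open_lip0_def)
  show "norm f = 0 \<longleftrightarrow> f = 0"
  proof (transfer, safe)
    fix f :: "'a \<Rightarrow> 'b" and C
    assume f: "f 0 = 0" "C-lipschitz_on UNIV f" "lip_const f = 0"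
    then have "f x = 0" for x
      using lip_const_bound[OF f(2), of x 0] by simp
    then show "f = (\<lambda>_. 0)" by auto
  next
    show "lip_const (\<lambda>_ :: 'a. 0 :: 'b) = 0"
      by (simp add: lip_const_def split_beta)
  qed
  show "norm (f + g) \<le> norm f + norm g"
  proof (transfer, safe)
    fix f g :: "'a \<Rightarrow> 'b" and C D
    assume f: "C-lipschitz_on UNIV f" and g: "D-lipschitz_on UNIV g"
    show "lip_const (\<lambda>x. f x + g x) \<le> lip_const f + lip_const g"
    proof (rule lip_const_le)
      fix x y
      have "norm (f x + g x - (f y + g y)) \<le> norm (f x - f y) + norm (g x - g y)"
        using norm_triangle_ineq[of "f x - f y" "g x - g y"] by (simp add: algebra_simps)
      then show "norm (f x + g x - (f y + g y)) \<le> (lip_const f + lip_const g) * norm (x - y)"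
        using lip_const_bound[OF f, of x y] lip_const_bound[OF g, of x y]
        by (simp add: algebra_simps)
    qed (use lip_const_nonneg[OF f] lip_const_nonneg[OF g] in simp)
  qed
  have le: "norm (c *\<^sub>R k) \<le> \<bar>c\<bar> * norm k" for c :: real and k :: "('a, 'b) lip0"
  proof (transfer, safe)
    fix c :: real and k :: "'a \<Rightarrow> 'b" and C
    assume k: "C-lipschitz_on UNIV k"
    show "lip_const (\<lambda>x. c *\<^sub>R k x) \<le> \<bar>c\<bar> * lip_const k"
    proof (rule lip_const_le)
      fix x y
      show "norm (c *\<^sub>R k x - c *\<^sub>R k y) \<le> \<bar>c\<bar> * lip_const k * norm (x - y)"
        using lip_const_bound[OF k, of x y]
        by (simp flip: scaleR_diff_right) (metis abs_ge_zero mult.assoc mult_left_mono)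
    qed (use lip_const_nonneg[OF k] in simp)
  qed
  show "norm (a *\<^sub>R f) = \<bar>a\<bar> * norm f"
  proof (cases "a = 0")
    case True
    have "norm (0 *\<^sub>R f) = 0"
      by transfer (simp add: lip_const_def split_beta)
    then show ?thesis using True by simp
  next
    case False
    have "inverse a *\<^sub>R (a *\<^sub>R f) = f"
      using False by transfer simp
    then have "norm f \<le> \<bar>inverse a\<bar> * norm (a *\<^sub>R f)"
      using le[of "inverse a" "a *\<^sub>R f"] by simp
    then have "\<bar>a\<bar> * norm f \<le> norm (a *\<^sub>R f)"
      using False by (simp add: field_simps)
    then show ?thesis using le[of a f] by simp
  qed
qed

end

declare [[coercion lip0_apply]]

lemma lip0_zero [simp]: "lip0_apply f 0 = 0"
  by transfer simp

lemma lip0_bound: "norm (lip0_apply f x - lip0_apply f y) \<le> norm f * norm (x - y)"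
  by transfer (auto intro: lip_const_bound)

lemma lip0_bound0: "norm (lip0_apply f x) \<le> norm f * norm x"
  using lip0_bound[of f x 0] by simp

lemma lip0_norm_le:
  assumes "\<And>x y. norm (lip0_apply f x - lip0_apply f y) \<le> C * norm (x - y)" "0 \<le> C"
  shows "norm f \<le> C"
  using assms by transfer (rule lip_const_le)

lemma lip0_apply_simps [simp]:
  "lip0_apply (f + g) x = lip0_apply f x + lip0_apply g x"
  "lip0_apply (f - g) x = lip0_apply f x - lip0_apply g x"
  "lip0_apply (r *\<^sub>R f) x = r *\<^sub>R lip0_apply f x"
  "lip0_apply 0 x = 0"
  by (transfer; simp)+

lemma lip0_eqI: "(\<And>x. lip0_apply f x = lip0_apply g x) \<Longrightarrow> f = g"
  by transfer auto

lemma bounded_linear_lipschitz0: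
  assumes "bounded_linear f"
  shows "f 0 = 0 \<and> (\<exists>C. C-lipschitz_on UNIV f)"
  using linear_0[OF bounded_linear.linear[OF assms]]
    bounded_linear.lipschitz_boundE[OF assms] by metis

lift_definition lip_of_blinfun ::
    "('a::real_normed_vector \<Rightarrow>\<^sub>L 'b::real_normed_vector) \<Rightarrow> ('a, 'b) lip0" is "\<lambda>f. f"
  by (rule bounded_linear_lipschitz0)

lemma lip_of_blinfun_apply [simp]: "lip0_apply (lip_of_blinfun f) x = f x"
  by transfer simp

lemma norm_lip_of_blinfun_le: "norm (lip_of_blinfun f) \<le> norm f"
  by (rule lip0_norm_le) (auto simp flip: blinfun.diff_right intro: norm_blinfun)

lift_definition lip_embed_dual ::
    "('a::real_normed_vector \<Rightarrow>\<^sub>L real) \<Rightarrow>\<^sub>L ('a, real) lip0" is lip_of_blinfun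
  by (rule bounded_linear_intro[where K = 1])
    (auto intro!: lip0_eqI simp: blinfun.bilinear_simps norm_lip_of_blinfun_le)

lift_definition lip0_compose ::
    "('b::real_normed_vector, 'c::real_normed_vector) lip0 \<Rightarrow> ('a::real_normed_vector, 'b) lip0 \<Rightarrow> ('a, 'c) lip0"
  is "\<lambda>g f x. g (f x)"
  by (auto dest: lipschitz_on_compose2 lipschitz_on_subset[OF _ subset_UNIV])

lemma lip0_compose_apply [simp]: "lip0_apply (lip0_compose g f) x = lip0_apply g (lip0_apply f x)"
  by transfer simp

section \<open>The Lipschitz-free space\<close>

lemma subspace_closure:
  fixes S :: "'a::real_normed_vector set"
  assumes "subspace S"
  shows "subspace (closure S)"
proof (rule subspaceI)
  show "0 \<in> closure S" using subspace_0[OF assms] closure_subset by blast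
next
  fix x y assume "x \<in> closure S" "y \<in> closure S"
  then obtain f g where f: "\<And>n. f n \<in> S" "f \<longlonglongrightarrow> x" and g: "\<And>n. g n \<in> S" "g \<longlonglongrightarrow> y"
    unfolding closure_sequential by blast
  have "(\<lambda>n. f n + g n) \<longlonglongrightarrow> x + y" using f g by (intro tendsto_intros)
  then show "x + y \<in> closure S"
    unfolding closure_sequential using f g
    by (intro exI[of _ "\<lambda>n. f n + g n"]) (auto intro: subspace_add[OF assms])
next
  fix c x assume "x \<in> closure S"
  then obtain f where f: "\<And>n. f n \<in> S" "f \<longlonglongrightarrow> x"
    unfolding closure_sequential by blast
  have "(\<lambda>n. c *\<^sub>R f n) \<longlonglongrightarrow> c *\<^sub>R x" using f by (intro tendsto_intros)
  then show "c *\<^sub>R x \<in> closure S"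
    unfolding closure_sequential using f
    by (intro exI[of _ "\<lambda>n. c *\<^sub>R f n"]) (auto intro: subspace_scale[OF assms])
qed

lift_definition lip_eval :: "'a::real_normed_vector \<Rightarrow> ('a, real) lip0 \<Rightarrow>\<^sub>L real" is "\<lambda>x f. lip0_apply f x"
proof -
  fix x :: 'a
  show "bounded_linear (\<lambda>f :: ('a, real) lip0. lip0_apply f x)"
    by (rule bounded_linear_intro[where K = "norm x"]) (simp_all add: lip0_bound0 del: real_norm_def)
qed

lemmas lip_eval_apply [simp] = lip_eval.rep_eq

typedef (overloaded) 'a::real_normed_vector free =
  "closure (span (range (lip_eval :: 'a \<Rightarrow> ('a, real) lip0 \<Rightarrow>\<^sub>L real)))"
  morphisms free_rep free_rep_abs
  by (rule exI[of _ 0]) (intro subsetD[OF closure_subset] span_zero)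

setup_lifting type_definition_free


instantiation free :: (real_normed_vector) real_normed_vector
begin

lift_definition zero_free :: "'a free" is 0
  by (rule subspace_0[OF subspace_closure[OF subspace_span]])

lift_definition plus_free :: "'a free \<Rightarrow> 'a free \<Rightarrow> 'a free" is "(+)"
  by (rule subspace_add[OF subspace_closure[OF subspace_span]])

lift_definition minus_free :: "'a free \<Rightarrow> 'a free \<Rightarrow> 'a free" is "(-)"
  by (rule subspace_diff[OF subspace_closure[OF subspace_span]])

lift_definition uminus_free :: "'a free \<Rightarrow> 'a free" is uminus
  by (rule subspace_neg[OF subspace_closure[OF subspace_span]])

lift_definition scaleR_free :: "real \<Rightarrow> 'a free \<Rightarrow> 'a free" is scaleR
  by (rule subspace_scale[OF subspace_closure[OF subspace_span]])

lift_definition norm_free :: "'a free \<Rightarrow> real" is norm .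

definition dist_free :: "'a free \<Rightarrow> 'a free \<Rightarrow> real"
  where "dist_free f g = norm (f - g)"

definition [code del]:
  "(uniformity :: ('a free \<times> 'a free) filter) = (INF e\<in>{0<..}. principal {(x, y). dist x y < e})"

definition open_free :: "'a free set \<Rightarrow> bool"
  where [code del]: "open_free S = (\<forall>x\<in>S. \<forall>\<^sub>F (x', y) in uniformity. x' = x \<longrightarrow> y \<in> S)"

definition sgn_free :: "'a free \<Rightarrow> 'a free"
  where "sgn_free f = inverse (norm f) *\<^sub>R f"

instance
proof
  fix f g h :: "'a free" and a b :: real
  show "f + g + h = f + (g + h)" "f + g = g + f" "0 + f = f" "- f + f = 0" "f - g = f + - g"
    "a *\<^sub>R (f + g) = a *\<^sub>R f + a *\<^sub>R g" "(a + b) *\<^sub>R f = a *\<^sub>R f + b *\<^sub>R f"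
    "a *\<^sub>R b *\<^sub>R f = (a * b) *\<^sub>R f" "1 *\<^sub>R f = f"
    by (transfer; simp add: algebra_simps)+
  show "dist f g = norm (f - g)" by (fact dist_free_def)
  show "sgn f = inverse (norm f) *\<^sub>R f" by (fact sgn_free_def)
  show "uniformity = (INF e\<in>{0<..}. principal {(x, y :: 'a free). dist x y < e})"
    by (fact uniformity_free_def)
  show "open U \<longleftrightarrow> (\<forall>x\<in>U. \<forall>\<^sub>F (x', y) in uniformity. x' = x \<longrightarrow> y \<in> U)"
    for U :: "'a free set"
    by (fact open_free_def)
  show "norm f = 0 \<longleftrightarrow> f = 0" "norm (f + g) \<le> norm f + norm g" "norm (a *\<^sub>R f) = \<bar>a\<bar> * norm f"
    by (transfer; simp add: norm_triangle_ineq)+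
qed

end

lemma free_rep_bounded_linear: "bounded_linear free_rep"
  by (rule bounded_linear_intro[where K = 1]; transfer; simp)

lemmas free_rep_simps [simp] =
  linear_add[OF bounded_linear.linear[OF free_rep_bounded_linear]]
  linear_diff[OF bounded_linear.linear[OF free_rep_bounded_linear]]
  linear_scale[OF bounded_linear.linear[OF free_rep_bounded_linear]]
  linear_0[OF bounded_linear.linear[OF free_rep_bounded_linear]]

lemma norm_free_rep [simp]: "norm (free_rep m) = norm m"
  by transfer simp

instance free :: (real_normed_vector) banach
proof
  fix X :: "nat \<Rightarrow> 'a free"
  assume X: "Cauchy X"
  have d: "dist (free_rep m) (free_rep n) = dist m n" for m n :: "'a free"
    by (simp add: dist_norm flip: free_rep_simps)
  have "Cauchy (\<lambda>n. free_rep (X n))"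
    using X by (simp add: Cauchy_def d)
  then obtain l where l: "(\<lambda>n. free_rep (X n)) \<longlonglongrightarrow> l"
    using Cauchy_convergent convergent_def by blast
  have "l \<in> closure (span (range lip_eval))"
    using closed_sequentially[OF closed_closure _ l] free_rep by blast
  then have "free_rep (free_rep_abs l) = l"
    by (rule free_rep_abs_inverse)
  then have "(\<lambda>n. free_rep (X n)) \<longlonglongrightarrow> free_rep (free_rep_abs l)"
    using l by simp
  then have "X \<longlonglongrightarrow> free_rep_abs l"
    by (simp add: tendsto_iff d)
  then show "convergent X" by (auto simp: convergent_def)
qed

lemma free_closed_span:
  assumes K: "subspace K" "closed K" and gen: "\<And>s. s \<in> span (range lip_eval) \<Longrightarrow> free_rep_abs s \<in> K"
  shows "m \<in> K"
proof -
  have d: "dist (free_rep m) (free_rep n) = dist m n" for m n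
    by (simp add: dist_norm flip: free_rep_simps)
  have "\<exists>s. (\<forall>n. s n \<in> span (range lip_eval)) \<and> s \<longlonglongrightarrow> free_rep m"
    using free_rep[of m] by (simp only: closure_sequential)
  then obtain s where "\<forall>n. s n \<in> span (range lip_eval)" "s \<longlonglongrightarrow> free_rep m"
    by (elim exE conjE)
  note s = spec[OF this(1)] this(2)
  have inv: "free_rep (free_rep_abs (s n)) = s n" for n
    by (intro free_rep_abs_inverse subsetD[OF closure_subset] s(1))
  have "dist (free_rep_abs (s n)) m = dist (s n) (free_rep m)" for n
    using d[of "free_rep_abs (s n)" m] by (simp only: inv)
  then have "(\<lambda>n. free_rep_abs (s n)) \<longlonglongrightarrow> m"
    using s(2) by (simp only: tendsto_iff)
  then show ?thesis
    by (rule closed_sequentially[OF K(2) gen[OF s(1)]])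
qed

lift_definition free_delta :: "'a::real_normed_vector \<Rightarrow> 'a free" is lip_eval
  by (intro subsetD[OF closure_subset] span_base rangeI)

lemma free_rep_delta [simp]: "free_rep (free_delta x) f = lip0_apply f x"
  by (simp add: free_delta.rep_eq)

lemma free_induct:
  fixes K :: "('a::real_normed_vector free) set"
  assumes K: "subspace K" "closed K" and gen: "\<And>x. free_delta x \<in> K"
  shows "m \<in> K"
proof (rule free_closed_span[OF K])
  fix s :: "('a, real) lip0 \<Rightarrow>\<^sub>L real" assume s: "s \<in> span (range lip_eval)"
  have "s \<in> free_rep ` K"
  proof (rule set_mp[OF span_minimal s])
    show "range lip_eval \<subseteq> free_rep ` K"
    proof safe
      fix x :: 'a
      show "lip_eval x \<in> free_rep ` K"
        unfolding free_delta.rep_eq[symmetric] by (rule imageI[OF gen])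
    qed
    show "subspace (free_rep ` K)"
      by (rule linear_subspace_image[OF bounded_linear.linear[OF free_rep_bounded_linear] K(1)])
  qed
  then obtain k where "k \<in> K" "s = free_rep k" by (rule imageE)
  then show "free_rep_abs s \<in> K" by (simp only: free_rep_inverse)
qed

lemma blinfun_eq_subspace: "subspace {m. blinfun_apply L m = blinfun_apply M m}"
  by (auto simp: subspace_def blinfun.bilinear_simps)

lemma blinfun_eq_closed: "closed {m. blinfun_apply L m = blinfun_apply M m}"
  by (intro closed_Collect_eq linear_continuous_on blinfun.bounded_linear_right)

lemma free_blinfun_eqI:
  fixes L M :: "'a::real_normed_vector free \<Rightarrow>\<^sub>L 'b::real_normed_vector"
  assumes "\<And>x. L (free_delta x) = M (free_delta x)"
  shows "L = M"
proof (rule blinfun_eqI)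
  fix m
  have "m \<in> {m. L m = M m}"
    by (rule free_induct[OF blinfun_eq_subspace blinfun_eq_closed]) (use assms in simp)
  then show "L m = M m" by simp
qed

lemma norm_free_delta_diff: "norm (free_delta x - free_delta y) = norm (x - y)"
proof (rule antisym)
  have "norm (free_rep (free_delta x - free_delta y)) \<le> norm (x - y)"
  proof (rule norm_blinfun_bound)
    fix f :: "('a, real) lip0"
    show "norm (free_rep (free_delta x - free_delta y) f) \<le> norm (x - y) * norm f"
      using lip0_bound[of f x y] by (simp add: blinfun.diff_left mult.commute)
  qed simp
  then show "norm (free_delta x - free_delta y) \<le> norm (x - y)"
    unfolding norm_free_rep .
next
  obtain \<phi> :: "'a \<Rightarrow>\<^sub>L real" where \<phi>: "norm \<phi> \<le> 1" "\<phi> (x - y) = norm (x - y)"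
    using norming_functional by metis
  have "norm (x - y) = norm (free_rep (free_delta x - free_delta y) (lip_of_blinfun \<phi>))"
    using \<phi> by (simp add: blinfun.bilinear_simps)
  also have "\<dots> \<le> norm (free_rep (free_delta x - free_delta y)) * norm (lip_of_blinfun \<phi>)"
    by (rule norm_blinfun)
  also have "\<dots> \<le> norm (free_delta x - free_delta y) * 1"
    unfolding norm_free_rep using \<phi> norm_lip_of_blinfun_le[of \<phi>] by (intro mult_left_mono) auto
  finally show "norm (x - y) \<le> norm (free_delta x - free_delta y)" by simp
qed

lemma norm_lip0_compose_dual_le:
  fixes \<phi> :: "'b::real_normed_vector \<Rightarrow>\<^sub>L 'c::real_normed_vector"
  shows "norm (lip0_compose (lip_of_blinfun \<phi>) f) \<le> norm \<phi> * norm f"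
proof (rule lip0_norm_le)
  fix x y
  have "norm (\<phi> (lip0_apply f x - lip0_apply f y)) \<le> norm \<phi> * (norm f * norm (x - y))"
    using norm_blinfun[of \<phi> "lip0_apply f x - lip0_apply f y"] lip0_bound[of f x y]
    by (meson mult_left_mono norm_ge_zero order_trans)
  then show "norm (lip0_apply (lip0_compose (lip_of_blinfun \<phi>) f) x
      - lip0_apply (lip0_compose (lip_of_blinfun \<phi>) f) y) \<le> norm \<phi> * norm f * norm (x - y)"
    by (simp add: blinfun.diff_right)
qed simp

lemma free_barycentre:
  fixes f :: "('a::real_normed_vector, 'b::banach) lip0"
  obtains L :: "'a free \<Rightarrow>\<^sub>L 'b" where "norm L \<le> norm f"
    "\<And>\<phi> :: 'b \<Rightarrow>\<^sub>L real. \<And>m. blinfun_apply \<phi> (blinfun_apply L m) = free_rep m (lip0_compose (lip_of_blinfun \<phi>) f)"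
proof -
  define G where "G \<phi> = lip0_compose (lip_of_blinfun \<phi>) f" for \<phi> :: "'b \<Rightarrow>\<^sub>L real"
  have nG: "norm (free_rep m (G \<phi>)) \<le> norm m * norm f" if "norm \<phi> \<le> 1" for m \<phi>
  proof -
    have "norm (G \<phi>) \<le> norm f"
      using norm_lip0_compose_dual_le[of \<phi> f] mult_right_mono[OF that norm_ge_zero[of f]]
      by (simp add: G_def)
    then show ?thesis
      using norm_blinfun[of "free_rep m" "G \<phi>"] mult_left_mono[of "norm (G \<phi>)" "norm f" "norm m"]
      by simp
  qed
  have bd: "norm y \<le> norm m * norm f" if y: "\<And>\<phi> :: 'b \<Rightarrow>\<^sub>L real. blinfun_apply \<phi> y = free_rep m (G \<phi>)" for y m
  proof -
    obtain \<phi> :: "'b \<Rightarrow>\<^sub>L real" where \<phi>: "norm \<phi> \<le> 1" "\<phi> y = norm y"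
      using norming_functional by metis
    show ?thesis using nG[OF \<phi>(1), of m] y[of \<phi>] \<phi>(2) by simp
  qed
  define K where "K = {m. \<exists>y. \<forall>\<phi> :: 'b \<Rightarrow>\<^sub>L real. blinfun_apply \<phi> y = free_rep m (G \<phi>)}"
  have "m \<in> K" for m
  proof (rule free_induct)
    show "free_delta x \<in> K" for x by (auto simp: K_def G_def)
    show "subspace K"
    proof (rule subspaceI)
      show "0 \<in> K" by (auto simp: K_def intro!: exI[of _ 0] simp: blinfun.bilinear_simps)
      show "m + n \<in> K" if "m \<in> K" "n \<in> K" for m n
        using that by (clarsimp simp: K_def) (metis blinfun.add_left blinfun.add_right)
      show "c *\<^sub>R m \<in> K" if "m \<in> K" for c m
        using that by (clarsimp simp: K_def) (metis blinfun.scaleR_left blinfun.scaleR_right real_scaleR_def)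
    qed
    show "closed K"
      unfolding closed_sequential_limits
    proof safe
      fix s l assume s: "\<forall>n. s n \<in> K" and l: "s \<longlonglongrightarrow> l"
      then obtain y where y: "\<And>n. \<And>\<phi> :: 'b \<Rightarrow>\<^sub>L real. blinfun_apply \<phi> (y n) = free_rep (s n) (G \<phi>)"
        unfolding K_def by simp metis
      have lip: "dist (y m) (y n) \<le> norm f * dist (s m) (s n)" for m n
        unfolding dist_norm using bd[of "y m - y n" "s m - s n"] y
        by (simp add: blinfun.bilinear_simps mult.commute)
      have "Cauchy y"
      proof (rule metric_CauchyI)
        fix e :: real assume "0 < e"
        then have e: "0 < e / (norm f + 1)" by (simp add: add_nonneg_pos)
        obtain N where N: "\<And>m n. m \<ge> N \<Longrightarrow> n \<ge> N \<Longrightarrow> dist (s m) (s n) < e / (norm f + 1)"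
          using metric_CauchyD[OF LIMSEQ_imp_Cauchy[OF l] e] by blast
        have "dist (y m) (y n) < e" if "m \<ge> N" "n \<ge> N" for m n
        proof -
          have "norm f * dist (s m) (s n) \<le> (norm f + 1) * dist (s m) (s n)"
            by (intro mult_right_mono) auto
          also have "\<dots> < e"
            using N[OF that] by (simp add: pos_less_divide_eq add_nonneg_pos mult.commute)
          finally show ?thesis using lip[of m n] by simp
        qed
        then show "\<exists>M. \<forall>m\<ge>M. \<forall>n\<ge>M. dist (y m) (y n) < e" by blast
      qed
      then obtain z where z: "y \<longlonglongrightarrow> z"
        using Cauchy_convergent convergent_def by blast
      have "\<phi> z = free_rep l (G \<phi>)" for \<phi> :: "'b \<Rightarrow>\<^sub>L real"
      proof (rule LIMSEQ_unique)
        show "(\<lambda>n. \<phi> (y n)) \<longlonglongrightarrow> \<phi> z" using z by (intro tendsto_intros)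
        show "(\<lambda>n. \<phi> (y n)) \<longlonglongrightarrow> free_rep l (G \<phi>)"
          unfolding y using bounded_linear.tendsto[OF free_rep_bounded_linear l]
          by (intro tendsto_intros)
      qed
      then show "l \<in> K" by (auto simp: K_def)
    qed
  qed
  then obtain h where h: "\<And>m. \<And>\<phi> :: 'b \<Rightarrow>\<^sub>L real. blinfun_apply \<phi> (h m) = free_rep m (G \<phi>)"
    unfolding K_def by simp metis
  have bl: "bounded_linear h"
  proof (rule bounded_linear_intro)
    show "h (m + n) = h m + h n" for m n
      by (rule functionals_separate) (simp add: h blinfun.bilinear_simps)
    show "h (c *\<^sub>R m) = c *\<^sub>R h m" for c m
      by (rule functionals_separate) (simp add: h blinfun.bilinear_simps)
    show "norm (h m) \<le> norm m * norm f" for m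
      by (rule bd) (rule h)
  qed
  show thesis
  proof (rule that[of "Blinfun h"])
    show "norm (Blinfun h) \<le> norm f"
      using bd[OF h] by (intro norm_blinfun_bound)
        (auto simp: bounded_linear_Blinfun_apply[OF bl] mult.commute)
  qed (auto simp: bounded_linear_Blinfun_apply[OF bl] h G_def)
qed

definition lip_lin :: "('a::real_normed_vector, 'b::banach) lip0 \<Rightarrow> 'a free \<Rightarrow>\<^sub>L 'b" where
  "lip_lin f = (THE L. \<forall>x. blinfun_apply L (free_delta x) = lip0_apply f x)"

lemma lip_lin_ex1:
  fixes f :: "('a::real_normed_vector, 'b::banach) lip0"
  shows "\<exists>!L. \<forall>x. blinfun_apply L (free_delta x) = lip0_apply f x"
proof -
  obtain L where L: "\<And>\<phi> :: 'b \<Rightarrow>\<^sub>L real. \<And>m. blinfun_apply \<phi> (blinfun_apply L m) = free_rep m (lip0_compose (lip_of_blinfun \<phi>) f)"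
    using free_barycentre by metis
  have "blinfun_apply L (free_delta x) = lip0_apply f x" for x
    by (rule functionals_separate) (simp add: L)
  then show ?thesis by (metis free_blinfun_eqI)
qed

lemma lip_lin_delta [simp]: "lip_lin f (free_delta x) = lip0_apply f x"
  using theI'[OF lip_lin_ex1, of f] by (simp add: lip_lin_def)

lemma norm_lip_lin: "norm (lip_lin f) = norm f"
proof (rule antisym)
  obtain L where L: "norm L \<le> norm f"
    "\<And>\<phi> :: 'b \<Rightarrow>\<^sub>L real. \<And>m. blinfun_apply \<phi> (blinfun_apply L m) = free_rep m (lip0_compose (lip_of_blinfun \<phi>) f)"
    using free_barycentre by metis
  have "blinfun_apply L (free_delta x) = lip0_apply f x" for x
    by (rule functionals_separate) (simp add: L)
  then have "L = lip_lin f" by (intro free_blinfun_eqI) simp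
  then show "norm (lip_lin f) \<le> norm f" using L by simp
  have "norm (lip0_apply f x - lip0_apply f y) \<le> norm (lip_lin f) * norm (x - y)" for x y
    using norm_blinfun[of "lip_lin f" "free_delta x - free_delta y"]
    by (simp add: blinfun.diff_right norm_free_delta_diff)
  then show "norm f \<le> norm (lip_lin f)" by (rule lip0_norm_le) simp
qed

definition free_beta :: "'a::banach free \<Rightarrow>\<^sub>L 'a" where
  "free_beta = (THE \<beta>. \<forall>(\<phi> :: 'a \<Rightarrow>\<^sub>L real) m. blinfun_apply \<phi> (blinfun_apply \<beta> m) = free_rep m (lip_embed_dual \<phi>))"

lemma free_beta_ex1:
  "\<exists>!\<beta> :: 'a::banach free \<Rightarrow>\<^sub>L 'a.
     \<forall>(\<phi> :: 'a \<Rightarrow>\<^sub>L real) m. blinfun_apply \<phi> (blinfun_apply \<beta> m) = free_rep m (lip_embed_dual \<phi>)"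
proof -
  have "lip0_compose (lip_of_blinfun \<phi>) (lip_of_blinfun id_blinfun) = lip_embed_dual \<phi>"
    for \<phi> :: "'a \<Rightarrow>\<^sub>L real"
    by (rule lip0_eqI) (simp add: lip_embed_dual.rep_eq)
  then obtain \<beta> :: "'a free \<Rightarrow>\<^sub>L 'a" where
    "\<And>(\<phi> :: 'a \<Rightarrow>\<^sub>L real) m. blinfun_apply \<phi> (blinfun_apply \<beta> m) = free_rep m (lip_embed_dual \<phi>)"
    using free_barycentre[of "lip_of_blinfun (id_blinfun :: 'a \<Rightarrow>\<^sub>L 'a)"] by metis
  then show ?thesis by (metis blinfun_eqI functionals_separate)
qed

lemma free_beta: "blinfun_apply \<phi> (free_beta m) = free_rep m (lip_embed_dual \<phi>)"
  using theI'[OF free_beta_ex1] unfolding free_beta_def by blast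

lemma free_beta_delta [simp]: "free_beta (free_delta x) = x"
  by (rule functionals_separate) (simp add: free_beta lip_embed_dual.rep_eq)

lemma free_delta_zero [simp]: "free_delta 0 = 0"
proof -
  have "free_rep (free_delta 0) = free_rep 0"
    by (rule blinfun_eqI) simp
  then show ?thesis by (simp only: free_rep_inject)
qed

lemma lip_of_free_aux:
  fixes L :: "'a::real_normed_vector free \<Rightarrow>\<^sub>L 'b::real_normed_vector"
  shows "norm (L (free_delta x) - L (free_delta y)) \<le> norm L * norm (x - y)"
  using norm_blinfun[of L "free_delta x - free_delta y"]
  by (simp add: norm_free_delta_diff blinfun.diff_right)

lemma lip_of_free_wd:
  fixes L :: "'a::real_normed_vector free \<Rightarrow>\<^sub>L 'b::real_normed_vector"
  shows "L (free_delta 0) = 0 \<and> (\<exists>C. C-lipschitz_on UNIV (\<lambda>x. L (free_delta x)))"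
proof -
  have "(norm L)-lipschitz_on UNIV (\<lambda>x. L (free_delta x))"
    by (rule lipschitz_onI) (simp_all add: dist_norm lip_of_free_aux)
  then show ?thesis by (auto simp: blinfun.zero_right)
qed

definition lip_of_free ::
    "('a::real_normed_vector free \<Rightarrow>\<^sub>L 'b::real_normed_vector) \<Rightarrow> ('a, 'b) lip0" where
  "lip_of_free L = Lip0 (\<lambda>x. L (free_delta x))"

lemma lip_of_free_apply [simp]: "lip0_apply (lip_of_free L) x = L (free_delta x)"
  using lip_of_free_wd[of L] by (simp add: lip_of_free_def Lip0_inverse)

lemma norm_lip_of_free_le: "norm (lip_of_free L) \<le> norm L"
  by (rule lip0_norm_le) (simp_all add: lip_of_free_aux)

text \<open>
  The identification of the dual of the Lipschitz-free space with the Lipschitz functions, inverse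
  to \<^const>\<open>lip_lin\<close>.
\<close>

lift_definition free_dual_iso ::
    "('a::real_normed_vector free \<Rightarrow>\<^sub>L real) \<Rightarrow>\<^sub>L ('a, real) lip0" is lip_of_free
  by (rule bounded_linear_intro[where K = 1])
    (auto intro!: lip0_eqI simp: blinfun.bilinear_simps norm_lip_of_free_le)

lemma free_dual_iso_lip_lin [simp]: "free_dual_iso (lip_lin f) = f"
  by (rule lip0_eqI) (simp add: free_dual_iso.rep_eq)

lemma lip_lin_free_dual_iso [simp]: "lip_lin (free_dual_iso u) = u"
  by (rule free_blinfun_eqI) (simp add: free_dual_iso.rep_eq)

lemma norm_free_dual_iso: "norm (free_dual_iso u) = norm u"
  by (metis lip_lin_free_dual_iso norm_lip_lin)

lemma free_rep_lip_lin: "free_rep m f = lip_lin f m"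
proof -
  have bl: "bounded_linear (\<lambda>m. free_rep m f)"
    by (rule bounded_linear_compose[OF blinfun.bounded_linear_left free_rep_bounded_linear])
  have "Blinfun (\<lambda>m. free_rep m f) = lip_lin f"
    by (rule free_blinfun_eqI) (simp add: bounded_linear_Blinfun_apply[OF bl])
  then show ?thesis by (metis bounded_linear_Blinfun_apply[OF bl])
qed

section \<open>Completion of a normed space\<close>

text \<open>The completion is realised as the closure of the canonical image in the bidual.\<close>

lift_definition dual_eval :: "'a::real_normed_vector \<Rightarrow> ('a \<Rightarrow>\<^sub>L real) \<Rightarrow>\<^sub>L real" is "\<lambda>x \<phi>. blinfun_apply \<phi> x"
  by (rule blinfun.bounded_linear_left)

lemmas dual_eval_apply [simp] = dual_eval.rep_eq

lemma linear_dual_eval: "linear dual_eval"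
  by (rule linearI; rule blinfun_eqI) (simp_all add: blinfun.bilinear_simps)

lemma norm_dual_eval: "norm (dual_eval x) = norm x"
proof (rule antisym)
  show "norm (dual_eval x) \<le> norm x"
  proof (rule norm_blinfun_bound)
    show "norm (dual_eval x \<phi>) \<le> norm x * norm \<phi>" for \<phi>
      using norm_blinfun[of \<phi> x] by (simp add: mult.commute)
  qed simp
  obtain \<phi> :: "'a \<Rightarrow>\<^sub>L real" where \<phi>: "norm \<phi> \<le> 1" "\<phi> x = norm x"
    using norming_functional by metis
  have "norm x = norm (dual_eval x \<phi>)" using \<phi> by simp
  also have "\<dots> \<le> norm (dual_eval x) * norm \<phi>" by (rule norm_blinfun)
  also have "\<dots> \<le> norm (dual_eval x)"
    using mult_left_mono[OF \<phi>(1), of "norm (dual_eval x)"] by simp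
  finally show "norm x \<le> norm (dual_eval x)" .
qed

lemma subspace_range_dual_eval: "subspace (range dual_eval)"
  by (rule linear_subspace_image[OF linear_dual_eval subspace_UNIV])

typedef (overloaded) 'a::real_normed_vector completion =
  "closure (range (dual_eval :: 'a \<Rightarrow> ('a \<Rightarrow>\<^sub>L real) \<Rightarrow>\<^sub>L real))"
  morphisms completion_rep completion_rep_abs
  by (rule exI[of _ "dual_eval 0"]) (intro subsetD[OF closure_subset] rangeI)

setup_lifting type_definition_completion

instantiation completion :: (real_normed_vector) real_normed_vector
begin

lift_definition zero_completion :: "'a completion" is 0
  by (rule subspace_0[OF subspace_closure[OF subspace_range_dual_eval]])

lift_definition plus_completion :: "'a completion \<Rightarrow> 'a completion \<Rightarrow> 'a completion" is "(+)"
  by (rule subspace_add[OF subspace_closure[OF subspace_range_dual_eval]])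

lift_definition minus_completion :: "'a completion \<Rightarrow> 'a completion \<Rightarrow> 'a completion" is "(-)"
  by (rule subspace_diff[OF subspace_closure[OF subspace_range_dual_eval]])

lift_definition uminus_completion :: "'a completion \<Rightarrow> 'a completion" is uminus
  by (rule subspace_neg[OF subspace_closure[OF subspace_range_dual_eval]])

lift_definition scaleR_completion :: "real \<Rightarrow> 'a completion \<Rightarrow> 'a completion" is scaleR
  by (rule subspace_scale[OF subspace_closure[OF subspace_range_dual_eval]])

lift_definition norm_completion :: "'a completion \<Rightarrow> real" is norm .

definition dist_completion :: "'a completion \<Rightarrow> 'a completion \<Rightarrow> real"
  where "dist_completion f g = norm (f - g)"

definition [code del]:
  "(uniformity :: ('a completion \<times> 'a completion) filter) = (INF e\<in>{0<..}. principal {(x, y). dist x y < e})"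

definition open_completion :: "'a completion set \<Rightarrow> bool"
  where [code del]: "open_completion S = (\<forall>x\<in>S. \<forall>\<^sub>F (x', y) in uniformity. x' = x \<longrightarrow> y \<in> S)"

definition sgn_completion :: "'a completion \<Rightarrow> 'a completion"
  where "sgn_completion f = inverse (norm f) *\<^sub>R f"

instance
proof
  fix f g h :: "'a completion" and a b :: real
  show "f + g + h = f + (g + h)" "f + g = g + f" "0 + f = f" "- f + f = 0" "f - g = f + - g"
    "a *\<^sub>R (f + g) = a *\<^sub>R f + a *\<^sub>R g" "(a + b) *\<^sub>R f = a *\<^sub>R f + b *\<^sub>R f"
    "a *\<^sub>R b *\<^sub>R f = (a * b) *\<^sub>R f" "1 *\<^sub>R f = f"
    by (transfer; simp add: algebra_simps)+
  show "dist f g = norm (f - g)" by (fact dist_completion_def)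
  show "sgn f = inverse (norm f) *\<^sub>R f" by (fact sgn_completion_def)
  show "uniformity = (INF e\<in>{0<..}. principal {(x, y :: 'a completion). dist x y < e})"
    by (fact uniformity_completion_def)
  show "open U \<longleftrightarrow> (\<forall>x\<in>U. \<forall>\<^sub>F (x', y) in uniformity. x' = x \<longrightarrow> y \<in> U)"
    for U :: "'a completion set"
    by (fact open_completion_def)
  show "norm f = 0 \<longleftrightarrow> f = 0" "norm (f + g) \<le> norm f + norm g" "norm (a *\<^sub>R f) = \<bar>a\<bar> * norm f"
    by (transfer; simp add: norm_triangle_ineq)+
qed

end

lemma completion_rep_bounded_linear: "bounded_linear completion_rep"
  by (rule bounded_linear_intro[where K = 1]; transfer; simp)

lemmas completion_rep_simps [simp] =
  linear_add[OF bounded_linear.linear[OF completion_rep_bounded_linear]]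
  linear_diff[OF bounded_linear.linear[OF completion_rep_bounded_linear]]
  linear_scale[OF bounded_linear.linear[OF completion_rep_bounded_linear]]
  linear_0[OF bounded_linear.linear[OF completion_rep_bounded_linear]]

lemma norm_completion_rep [simp]: "norm (completion_rep m) = norm m"
  by transfer simp

instance completion :: (real_normed_vector) banach
proof
  fix X :: "nat \<Rightarrow> 'a completion"
  assume X: "Cauchy X"
  have d: "dist (completion_rep m) (completion_rep n) = dist m n" for m n :: "'a completion"
    by (simp add: dist_norm flip: completion_rep_simps)
  have "Cauchy (\<lambda>n. completion_rep (X n))"
    using X by (simp add: Cauchy_def d)
  then obtain l where l: "(\<lambda>n. completion_rep (X n)) \<longlonglongrightarrow> l"
    using Cauchy_convergent convergent_def by blast
  have "l \<in> closure (range dual_eval)"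
    using closed_sequentially[OF closed_closure _ l] completion_rep by blast
  then have "completion_rep (completion_rep_abs l) = l"
    by (rule completion_rep_abs_inverse)
  then have "(\<lambda>n. completion_rep (X n)) \<longlonglongrightarrow> completion_rep (completion_rep_abs l)"
    using l by simp
  then have "X \<longlonglongrightarrow> completion_rep_abs l"
    by (simp add: tendsto_iff d)
  then show "convergent X" by (auto simp: convergent_def)
qed

lemma completion_closed_span:
  assumes K: "subspace K" "closed K" and gen: "\<And>s. s \<in> range dual_eval \<Longrightarrow> completion_rep_abs s \<in> K"
  shows "m \<in> K"
proof -
  have d: "dist (completion_rep m) (completion_rep n) = dist m n" for m n
    by (simp add: dist_norm flip: completion_rep_simps)
  have "\<exists>s. (\<forall>n. s n \<in> range dual_eval) \<and> s \<longlonglongrightarrow> completion_rep m"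
    using completion_rep[of m] by (simp only: closure_sequential)
  then obtain s where "\<forall>n. s n \<in> range dual_eval" "s \<longlonglongrightarrow> completion_rep m"
    by (elim exE conjE)
  note s = spec[OF this(1)] this(2)
  have inv: "completion_rep (completion_rep_abs (s n)) = s n" for n
    by (intro completion_rep_abs_inverse subsetD[OF closure_subset] s(1))
  have "dist (completion_rep_abs (s n)) m = dist (s n) (completion_rep m)" for n
    using d[of "completion_rep_abs (s n)" m] by (simp only: inv)
  then have "(\<lambda>n. completion_rep_abs (s n)) \<longlonglongrightarrow> m"
    using s(2) by (simp only: tendsto_iff)
  then show ?thesis
    by (rule closed_sequentially[OF K(2) gen[OF s(1)]])
qed

lift_definition to_completion :: "'a::real_normed_vector \<Rightarrow> 'a completion" is dual_eval
  by (intro subsetD[OF closure_subset] rangeI)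

lemma to_completion_linear: "linear to_completion"
  by (rule linearI; transfer) (simp_all add: linear_add[OF linear_dual_eval] linear_scale[OF linear_dual_eval])

lemma norm_to_completion [simp]: "norm (to_completion x) = norm x"
  by transfer (rule norm_dual_eval)

lemma completion_induct:
  fixes K :: "'a::real_normed_vector completion set"
  assumes K: "subspace K" "closed K" and gen: "\<And>x. to_completion x \<in> K"
  shows "m \<in> K"
proof (rule completion_closed_span[OF K])
  fix s :: "('a \<Rightarrow>\<^sub>L real) \<Rightarrow>\<^sub>L real" assume "s \<in> range dual_eval"
  then obtain x where "s = dual_eval x" by (rule rangeE)
  then have "completion_rep_abs s = to_completion x"
    by (metis completion_rep_inverse to_completion.rep_eq)
  then show "completion_rep_abs s \<in> K" using gen by simp
qed

lemma to_completion_dense: "closure (range to_completion) = UNIV"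
proof (intro equalityI subsetI UNIV_I)
  fix z :: "'a completion"
  have "subspace (closure (range (to_completion :: 'a \<Rightarrow> 'a completion)))"
    by (rule subspace_closure[OF linear_subspace_image[OF to_completion_linear subspace_UNIV]])
  then show "z \<in> closure (range to_completion)"
    by (rule completion_induct[OF _ closed_closure]) (rule subsetD[OF closure_subset rangeI])
qed

section \<open>The projective tensor product\<close>

lift_definition bilin_eval ::
    "'a::real_normed_vector \<Rightarrow> 'b::real_normed_vector \<Rightarrow> ('a \<Rightarrow>\<^sub>L 'b \<Rightarrow>\<^sub>L real) \<Rightarrow>\<^sub>L real"
  is "\<lambda>x y B. blinfun_apply (blinfun_apply B x) y"
  by (rule bounded_linear_compose[OF blinfun.bounded_linear_left blinfun.bounded_linear_left])

lemmas bilin_eval_apply [simp] = bilin_eval.rep_eq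

text \<open>
  The algebraic tensor product, realised as the span of the evaluations \<open>B \<mapsto> B x y\<close> on
  bounded bilinear forms; that no further relations are introduced by this is lemma
  \<open>tensor_zero_imp\<close> below.
\<close>

typedef (overloaded) ('a::real_normed_vector, 'b::real_normed_vector) tensor =
  "span (range (\<lambda>(x, y). bilin_eval x y)) :: (('a \<Rightarrow>\<^sub>L 'b \<Rightarrow>\<^sub>L real) \<Rightarrow>\<^sub>L real) set"
  morphisms tensor_rep tensor_rep_abs
  by (rule exI[of _ 0]) (rule span_zero)

setup_lifting type_definition_tensor

instantiation tensor :: (real_normed_vector, real_normed_vector) real_vector
begin

lift_definition zero_tensor :: "('a, 'b) tensor" is 0
  by (rule subspace_0[OF subspace_span])

lift_definition plus_tensor :: "('a, 'b) tensor \<Rightarrow> ('a, 'b) tensor \<Rightarrow> ('a, 'b) tensor" is "(+)"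
  by (rule subspace_add[OF subspace_span])

lift_definition minus_tensor :: "('a, 'b) tensor \<Rightarrow> ('a, 'b) tensor \<Rightarrow> ('a, 'b) tensor" is "(-)"
  by (rule subspace_diff[OF subspace_span])

lift_definition uminus_tensor :: "('a, 'b) tensor \<Rightarrow> ('a, 'b) tensor" is uminus
  by (rule subspace_neg[OF subspace_span])

lift_definition scaleR_tensor :: "real \<Rightarrow> ('a, 'b) tensor \<Rightarrow> ('a, 'b) tensor" is scaleR
  by (rule subspace_scale[OF subspace_span])

instance
  by standard (transfer; simp add: algebra_simps)+

end

lemma tensor_rep_linear: "linear tensor_rep"
  by (rule linearI; transfer; simp)

lemmas tensor_rep_simps [simp] =
  linear_add[OF tensor_rep_linear] linear_diff[OF tensor_rep_linear]
  linear_scale[OF tensor_rep_linear] linear_0[OF tensor_rep_linear]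

lift_definition tensor_prod ::
    "'a::real_normed_vector \<Rightarrow> 'b::real_normed_vector \<Rightarrow> ('a, 'b) tensor" is bilin_eval
  by (rule span_base) auto

lemma tensor_rep_prod [simp]: "tensor_rep (tensor_prod x y) B = B x y"
  by (simp add: tensor_prod.rep_eq)

lemma tensor_eqI: "(\<And>B. blinfun_apply (tensor_rep u) B = tensor_rep v B) \<Longrightarrow> u = v"
  by (metis blinfun_eqI tensor_rep_inject)

lemma tensor_prod_simps:
  "tensor_prod (x + x') y = tensor_prod x y + tensor_prod x' y"
  "tensor_prod x (y + y') = tensor_prod x y + tensor_prod x y'"
  "tensor_prod (c *\<^sub>R x) y = c *\<^sub>R tensor_prod x y"
  "tensor_prod x (c *\<^sub>R y) = c *\<^sub>R tensor_prod x y"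
  by (rule tensor_eqI; simp add: blinfun.bilinear_simps)+

definition tensor_sum :: "('a::real_normed_vector \<times> 'b::real_normed_vector) list \<Rightarrow> ('a, 'b) tensor" where
  "tensor_sum xs = (\<Sum>(x, y)\<leftarrow>xs. tensor_prod x y)"

definition tensor_cost :: "('a::real_normed_vector \<times> 'b::real_normed_vector) list \<Rightarrow> real" where
  "tensor_cost xs = (\<Sum>(x, y)\<leftarrow>xs. norm x * norm y)"

lemma tensor_sum_simps [simp]:
  "tensor_sum [] = 0" "tensor_sum ((x, y) # xs) = tensor_prod x y + tensor_sum xs"
  "tensor_sum (xs @ ys) = tensor_sum xs + tensor_sum ys"
  by (simp_all add: tensor_sum_def)

lemma tensor_cost_simps [simp]:
  "tensor_cost [] = 0" "tensor_cost ((x, y) # xs) = norm x * norm y + tensor_cost xs"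
  "tensor_cost (xs @ ys) = tensor_cost xs + tensor_cost ys"
  by (simp_all add: tensor_cost_def)

lemma tensor_cost_nonneg: "0 \<le> tensor_cost xs"
  by (induction xs) auto

lemma tensor_scale:
  "\<exists>ys. tensor_sum ys = c *\<^sub>R tensor_sum xs \<and> tensor_cost ys = \<bar>c\<bar> * tensor_cost xs"
proof (induction xs)
  case Nil
  show ?case by (rule exI[of _ "[]"]) simp
next
  case (Cons p xs)
  obtain x y where p: "p = (x, y)" by (cases p)
  from Cons obtain ys where "tensor_sum ys = c *\<^sub>R tensor_sum xs" "tensor_cost ys = \<bar>c\<bar> * tensor_cost xs"
    by blast
  then show ?case
    by (intro exI[of _ "(c *\<^sub>R x, y) # ys"]) (simp add: p tensor_prod_simps algebra_simps)
qed

lemma tensor_sum_ex: "\<exists>xs. u = tensor_sum xs"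
proof -
  have "tensor_rep u \<in> span (range (\<lambda>(x, y). bilin_eval x y))" by (rule tensor_rep)
  then have "\<exists>xs. tensor_rep u = tensor_rep (tensor_sum xs)"
  proof (induction rule: span_induct_alt)
    case base
    show ?case by (rule exI[of _ "[]"]) simp
  next
    case (step c s v)
    then obtain xs where xs: "v = tensor_rep (tensor_sum xs)" by blast
    obtain x y where "s = bilin_eval x y" using step by auto
    then have "c *\<^sub>R s + v = tensor_rep (tensor_sum ((c *\<^sub>R x, y) # xs))"
      using xs by (simp add: tensor_prod_simps tensor_prod.rep_eq)
    then show ?case by blast
  qed
  then show ?thesis by (simp add: tensor_rep_inject)
qed

lemma tensor_rep_bound: "\<bar>tensor_rep (tensor_sum xs) B\<bar> \<le> norm B * tensor_cost xs"
proof (induction xs)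
  case (Cons p xs)
  obtain x y where p: "p = (x, y)" by (cases p)
  have "\<bar>B x y\<bar> \<le> norm B * norm x * norm y"
    using norm_blinfun[of "B x" y] mult_right_mono[OF norm_blinfun[of B x] norm_ge_zero[of y]] by simp
  with Cons show ?case by (simp add: p blinfun.bilinear_simps algebra_simps)
qed simp

instantiation tensor :: (real_normed_vector, real_normed_vector) real_normed_vector
begin

definition norm_tensor :: "('a, 'b) tensor \<Rightarrow> real" where
  "norm_tensor u = Inf {tensor_cost xs | xs. u = tensor_sum xs}"

definition dist_tensor :: "('a, 'b) tensor \<Rightarrow> ('a, 'b) tensor \<Rightarrow> real"
  where "dist_tensor f g = norm (f - g)"

definition [code del]:
  "(uniformity :: (('a, 'b) tensor \<times> ('a, 'b) tensor) filter) = (INF e\<in>{0<..}. principal {(x, y). dist x y < e})"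

definition open_tensor :: "('a, 'b) tensor set \<Rightarrow> bool"
  where [code del]: "open_tensor S = (\<forall>x\<in>S. \<forall>\<^sub>F (x', y) in uniformity. x' = x \<longrightarrow> y \<in> S)"

definition sgn_tensor :: "('a, 'b) tensor \<Rightarrow> ('a, 'b) tensor"
  where "sgn_tensor f = inverse (norm f) *\<^sub>R f"

instance
proof
  fix f g :: "('a, 'b) tensor" and a :: real
  show "dist f g = norm (f - g)" by (fact dist_tensor_def)
  show "sgn f = inverse (norm f) *\<^sub>R f" by (fact sgn_tensor_def)
  show "uniformity = (INF e\<in>{0<..}. principal {(x, y :: ('a, 'b) tensor). dist x y < e})"
    by (fact uniformity_tensor_def)
  show "open U \<longleftrightarrow> (\<forall>x\<in>U. \<forall>\<^sub>F (x', y) in uniformity. x' = x \<longrightarrow> y \<in> U)"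
    for U :: "('a, 'b) tensor set"
    by (fact open_tensor_def)
  define R where "R u = {tensor_cost xs | xs. u = tensor_sum xs}" for u :: "('a, 'b) tensor"
  have nR: "norm u = Inf (R u)" for u by (simp add: norm_tensor_def R_def)
  have ne: "R u \<noteq> {}" for u using tensor_sum_ex[of u] by (auto simp: R_def)
  have bdd: "bdd_below (R u)" for u
    by (rule bdd_belowI[of _ 0]) (auto simp: R_def tensor_cost_nonneg)
  have up: "norm (tensor_sum xs) \<le> tensor_cost xs" for xs :: "('a \<times> 'b) list"
    unfolding nR by (rule cInf_lower[OF _ bdd]) (auto simp: R_def)
  have low: "b \<le> norm u" if "\<And>xs. u = tensor_sum xs \<Longrightarrow> b \<le> tensor_cost xs" for u b
    unfolding nR by (rule cInf_greatest[OF ne]) (use that in \<open>auto simp: R_def\<close>)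
  have ge0: "0 \<le> norm u" for u :: "('a, 'b) tensor"
    by (rule low) (rule tensor_cost_nonneg)
  have z: "norm (0 :: ('a, 'b) tensor) = 0"
    using up[of "[]"] ge0[of 0] by simp
  show "norm f = 0 \<longleftrightarrow> f = 0"
  proof
    assume n: "norm f = 0"
    show "f = 0"
    proof (rule tensor_eqI)
      fix B :: "'a \<Rightarrow>\<^sub>L 'b \<Rightarrow>\<^sub>L real"
      have "\<bar>tensor_rep f B\<bar> / (norm B + 1) \<le> norm f"
      proof (rule low)
        fix xs assume xs: "f = tensor_sum xs"
        have "norm B * tensor_cost xs \<le> (norm B + 1) * tensor_cost xs"
          by (rule mult_right_mono) (simp_all add: tensor_cost_nonneg)
        then show "\<bar>tensor_rep f B\<bar> / (norm B + 1) \<le> tensor_cost xs"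
          using tensor_rep_bound[of xs B]
          by (simp add: xs pos_divide_le_eq add_nonneg_pos mult.commute)
      qed
      then show "tensor_rep f B = tensor_rep 0 B"
        by (simp add: n pos_divide_le_eq add_nonneg_pos)
    qed
  qed (simp add: z)
  show "norm (f + g) \<le> norm f + norm g"
  proof -
    have "norm (f + g) - norm g \<le> norm f"
    proof (rule low)
      fix xs assume xs: "f = tensor_sum xs"
      have "norm (f + g) - tensor_cost xs \<le> norm g"
      proof (rule low)
        fix ys assume ys: "g = tensor_sum ys"
        show "norm (f + g) - tensor_cost xs \<le> tensor_cost ys"
          using up[of "xs @ ys"] by (simp add: xs ys)
      qed
      then show "norm (f + g) - norm g \<le> tensor_cost xs" by simp
    qed
    then show ?thesis by simp
  qed
  have le: "norm (c *\<^sub>R u) \<le> \<bar>c\<bar> * norm u" if c: "c \<noteq> 0" for c and u :: "('a, 'b) tensor"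
  proof -
    have "norm (c *\<^sub>R u) / \<bar>c\<bar> \<le> norm u"
    proof (rule low)
      fix xs assume xs: "u = tensor_sum xs"
      obtain ys where ys: "tensor_sum ys = c *\<^sub>R tensor_sum xs" "tensor_cost ys = \<bar>c\<bar> * tensor_cost xs"
        using tensor_scale by blast
      show "norm (c *\<^sub>R u) / \<bar>c\<bar> \<le> tensor_cost xs"
        using up[of ys] c by (simp add: xs ys pos_divide_le_eq mult.commute)
    qed
    then show ?thesis using c by (simp add: pos_divide_le_eq mult.commute)
  qed
  show "norm (a *\<^sub>R f) = \<bar>a\<bar> * norm f"
  proof (cases "a = 0")
    case True
    then show ?thesis by (simp add: z)
  next
    case False
    have "norm f \<le> \<bar>inverse a\<bar> * norm (a *\<^sub>R f)"
      using le[of "inverse a" "a *\<^sub>R f"] False by simp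
    then have "\<bar>a\<bar> * norm f \<le> norm (a *\<^sub>R f)"
      using False by (simp add: field_simps)
    then show ?thesis using le[OF False, of f] by simp
  qed
qed

end

lemma norm_tensor_le: "norm (tensor_sum xs) \<le> tensor_cost xs"
  unfolding norm_tensor_def
  by (rule cInf_lower) (auto intro!: bdd_belowI[of _ 0] simp: tensor_cost_nonneg)

lemma norm_tensor_greatest:
  assumes "\<And>xs. u = tensor_sum xs \<Longrightarrow> b \<le> tensor_cost xs"
  shows "b \<le> norm u"
  unfolding norm_tensor_def
  by (rule cInf_greatest) (use assms tensor_sum_ex[of u] in auto)

lemma tensor_zero_imp:
  fixes xs :: "('a::real_normed_vector \<times> 'b::real_normed_vector) list"
    and h :: "'a \<Rightarrow> 'b \<Rightarrow> 'c::real_vector"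
  assumes "tensor_sum xs = 0"
    and h: "\<And>y. linear (\<lambda>x. h x y)" "\<And>x. linear (h x)"
  shows "(\<Sum>(x, y)\<leftarrow>xs. h x y) = 0"
  using assms(1)
proof (induction "length xs" arbitrary: xs)
  case (Suc n)
  obtain x y zs where xs: "xs = (x, y) # zs" using Suc.hyps(2) by (cases xs) auto
  have n: "n = length zs" using Suc.hyps(2) xs by simp
  show ?case
  proof (cases "x = 0")
    case True
    have "tensor_prod x y = 0" unfolding True using tensor_prod_simps(3)[of 0 0 y] by simp
    then have "tensor_sum zs = 0" using Suc.prems xs by simp
    then show ?thesis using Suc.hyps(1)[OF n] xs True linear_0[OF h(1)] by simp
  next
    case False
    obtain \<phi> :: "'a \<Rightarrow>\<^sub>L real" where \<phi>: "\<phi> x = norm x" using norming_functional by metis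
    define c where "c x' = \<phi> x' / norm x" for x'
    have lin: "(\<Sum>(x', y')\<leftarrow>ls. k (x' - c x' *\<^sub>R x) y') = (\<Sum>(x', y')\<leftarrow>ls. k x' y') - k x (\<Sum>(x', y')\<leftarrow>ls. c x' *\<^sub>R y')"
      if "\<And>y. linear (\<lambda>x. k x y)" "\<And>x. linear (k x)"
      for k :: "'a \<Rightarrow> 'b \<Rightarrow> 'd::real_vector" and ls
    proof (induction ls)
      case Nil
      then show ?case by (simp add: linear_0[OF that(2)])
    next
      case (Cons p ls)
      obtain u v where "p = (u, v)" by (cases p)
      with Cons show ?case
        by (simp add: linear_diff[OF that(1)] linear_scale[OF that(1)] linear_add[OF that(2)] linear_scale[OF that(2)])
    qed
    have y: "y = - (\<Sum>(x', y')\<leftarrow>zs. c x' *\<^sub>R y')"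
    proof (rule functionals_separate)
      fix \<psi> :: "'b \<Rightarrow>\<^sub>L real"
      define B where "B = Blinfun (\<lambda>x'. (\<phi> x') *\<^sub>R \<psi>)"
      have bl: "bounded_linear (\<lambda>x'. (\<phi> x') *\<^sub>R \<psi>)"
        by (intro bounded_linear_scaleR_const blinfun.bounded_linear_right)
      have B: "B x' y' = \<phi> x' * \<psi> y'" for x' y'
        by (simp add: B_def bounded_linear_Blinfun_apply[OF bl] blinfun.scaleR_left)
      have rep: "tensor_rep (tensor_sum ls) B = (\<Sum>(x', y')\<leftarrow>ls. \<phi> x' * \<psi> y')" for ls
        by (induction ls) (auto simp: B blinfun.bilinear_simps)
      have "\<psi> (\<Sum>(x', y')\<leftarrow>ls. c x' *\<^sub>R y') = (\<Sum>(x', y')\<leftarrow>ls. \<phi> x' * \<psi> y') / norm x" for ls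
        by (induction ls) (auto simp: blinfun.bilinear_simps c_def add_divide_distrib)
      moreover have "norm x * \<psi> y + (\<Sum>(x', y')\<leftarrow>zs. \<phi> x' * \<psi> y') = 0"
        using trans[OF rep[of xs, symmetric] arg_cong[OF Suc.prems, of "\<lambda>u. tensor_rep u B"]]
        by (simp add: xs \<phi> blinfun.zero_left)
      ultimately have "norm x * (\<psi> y + \<psi> (\<Sum>(x', y')\<leftarrow>zs. c x' *\<^sub>R y')) = 0"
        using False by (simp add: distrib_left)
      then show "\<psi> y = \<psi> (- (\<Sum>(x', y')\<leftarrow>zs. c x' *\<^sub>R y'))"
        using False by (simp add: blinfun.minus_right eq_neg_iff_add_eq_0)
    qed
    define ws where "ws = map (\<lambda>(x', y'). (x' - c x' *\<^sub>R x, y')) zs"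
    have sum_ws: "(\<Sum>(x', y')\<leftarrow>ws. k x' y') = (\<Sum>(x', y')\<leftarrow>xs. k x' y')"
      if k: "\<And>y. linear (\<lambda>x. k x y)" "\<And>x. linear (k x)" for k :: "'a \<Rightarrow> 'b \<Rightarrow> 'd::real_vector"
    proof -
      have "(\<Sum>(x', y')\<leftarrow>ws. k x' y') = (\<Sum>(x', y')\<leftarrow>zs. k (x' - c x' *\<^sub>R x) y')"
        by (simp add: ws_def o_def case_prod_unfold)
      also have "\<dots> = (\<Sum>(x', y')\<leftarrow>zs. k x' y') + k x y"
        unfolding lin[OF k] by (subst y) (simp add: linear_neg[OF k(2)])
      finally show ?thesis by (simp add: xs)
    qed
    have "tensor_sum ws = tensor_sum xs"
      unfolding tensor_sum_def
      by (rule sum_ws) (auto intro!: linearI simp: tensor_prod_simps)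
    then have "(\<Sum>(x, y)\<leftarrow>ws. h x y) = 0"
      using Suc.hyps(1)[of ws] Suc.prems n by (simp add: ws_def)
    then show ?thesis using sum_ws[OF h] by simp
  qed
qed simp

type_synonym ('a, 'b) ptensor = "('a, 'b) tensor completion"

definition ptensor_prod ::
    "'a::real_normed_vector \<Rightarrow> 'b::real_normed_vector \<Rightarrow> ('a, 'b) ptensor" where
  "ptensor_prod x y = to_completion (tensor_prod x y)"

lemma ptensor_functional_ex1:
  fixes B :: "'a::real_normed_vector \<Rightarrow>\<^sub>L 'b::real_normed_vector \<Rightarrow>\<^sub>L real"
  shows "\<exists>!\<Phi> :: ('a, 'b) ptensor \<Rightarrow>\<^sub>L real. \<forall>x y. blinfun_apply \<Phi> (ptensor_prod x y) = B x y"
proof (rule ex_ex1I)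
  have bd: "\<bar>tensor_rep u B\<bar> \<le> norm u * norm B" for u :: "('a, 'b) tensor"
  proof (cases "norm B = 0")
    case False
    have "\<bar>tensor_rep u B\<bar> / norm B \<le> norm u"
    proof (rule norm_tensor_greatest)
      fix xs assume "u = tensor_sum xs"
      then show "\<bar>tensor_rep u B\<bar> / norm B \<le> tensor_cost xs"
        using tensor_rep_bound[of xs B] False by (simp add: pos_divide_le_eq mult.commute)
    qed
    then show ?thesis using False by (simp add: pos_divide_le_eq)
  qed (simp add: blinfun.zero_right)
  have bl: "bounded_linear (\<lambda>u. tensor_rep u B)"
    by (rule bounded_linear_intro[where K = "norm B"]) (simp_all add: blinfun.bilinear_simps bd)
  have bl': "bounded_linear (\<lambda>z. completion_rep z (Blinfun (\<lambda>u. tensor_rep u B)))"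
    by (rule bounded_linear_compose[OF blinfun.bounded_linear_left completion_rep_bounded_linear])
  show "\<exists>\<Phi> :: ('a, 'b) ptensor \<Rightarrow>\<^sub>L real. \<forall>x y. blinfun_apply \<Phi> (ptensor_prod x y) = B x y"
    by (rule exI[of _ "Blinfun (\<lambda>z. completion_rep z (Blinfun (\<lambda>u. tensor_rep u B)))"])
      (simp add: bounded_linear_Blinfun_apply[OF bl'] ptensor_prod_def to_completion.rep_eq
        bounded_linear_Blinfun_apply[OF bl])
next
  fix \<Phi> \<Psi> :: "('a, 'b) ptensor \<Rightarrow>\<^sub>L real"
  assume eq: "\<forall>x y. \<Phi> (ptensor_prod x y) = B x y" "\<forall>x y. \<Psi> (ptensor_prod x y) = B x y"
  have ts: "\<Phi> (to_completion (tensor_sum xs)) = \<Psi> (to_completion (tensor_sum xs))" for xs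
    by (induction xs)
      (use eq in \<open>auto simp: linear_0[OF to_completion_linear] linear_add[OF to_completion_linear]
        blinfun.bilinear_simps ptensor_prod_def\<close>)
  show "\<Phi> = \<Psi>"
  proof (rule blinfun_eqI)
    fix z
    have "z \<in> {z. blinfun_apply \<Phi> z = blinfun_apply \<Psi> z}"
    proof (rule completion_induct[OF blinfun_eq_subspace blinfun_eq_closed])
      fix u :: "('a, 'b) tensor"
      obtain xs where u: "u = tensor_sum xs" using tensor_sum_ex[of u] by (rule exE)
      show "to_completion u \<in> {z. blinfun_apply \<Phi> z = blinfun_apply \<Psi> z}"
        unfolding u mem_Collect_eq by (rule ts)
    qed
    then show "\<Phi> z = \<Psi> z" by simp
  qed
qed

section \<open>Compact-open topology and weak-star topology\<close>

text \<open>
  Uniform convergence on compact sets. On the subspace of continuous maps this is the compact-open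
  topology.
\<close>

definition compact_open :: "('a::metric_space \<Rightarrow> 'b::metric_space) topology" where
  "compact_open = topology (\<lambda>U. \<forall>f\<in>U. \<exists>K e. compact K \<and> 0 < e \<and> {g. \<forall>x\<in>K. dist (g x) (f x) < e} \<subseteq> U)"

lemma openin_compact_open:
  "openin compact_open U \<longleftrightarrow>
    (\<forall>f\<in>U. \<exists>K e. compact K \<and> 0 < e \<and> {g. \<forall>x\<in>K. dist (g x) (f x) < e} \<subseteq> U)"
proof -
  define P where "P f U \<longleftrightarrow> (\<exists>K e. compact K \<and> 0 < e \<and> {g. \<forall>x\<in>K. dist (g x) (f x) < e} \<subseteq> U)"
    for f :: "'a \<Rightarrow> 'b" and U
  have mono: "P f V" if "P f U" "U \<subseteq> V" for f U V
    using that unfolding P_def by (meson order_trans)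
  have int: "P f (U \<inter> V)" if U: "P f U" and V: "P f V" for f U V
  proof -
    obtain K e where K: "compact K" "0 < e" "{g. \<forall>x\<in>K. dist (g x) (f x) < e} \<subseteq> U"
      using U by (auto simp: P_def)
    obtain L d where L: "compact L" "0 < d" "{g. \<forall>x\<in>L. dist (g x) (f x) < d} \<subseteq> V"
      using V by (auto simp: P_def)
    have "{g. \<forall>x\<in>K \<union> L. dist (g x) (f x) < min e d} \<subseteq> U \<inter> V"
      using K(3) L(3) by auto
    then show ?thesis
      unfolding P_def using K L by (intro exI[of _ "K \<union> L"] exI[of _ "min e d"]) (auto simp: compact_Un)
  qed
  have "istopology (\<lambda>U. \<forall>f\<in>U. P f U)"
    unfolding istopology_def
  proof (intro conjI allI impI ballI)
    fix S T :: "('a \<Rightarrow> 'b) set" and f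
    assume "\<forall>f\<in>S. P f S" "\<forall>f\<in>T. P f T" "f \<in> S \<inter> T"
    then show "P f (S \<inter> T)" by (auto intro!: int)
  next
    fix \<K> :: "('a \<Rightarrow> 'b) set set" and f
    assume "\<forall>K\<in>\<K>. \<forall>f\<in>K. P f K" "f \<in> \<Union>\<K>"
    then obtain K where "K \<in> \<K>" "P f K" by auto
    from this(2,1) show "P f (\<Union>\<K>)" by (rule mono[of f K, OF _ Union_upper])
  qed
  then show ?thesis
    unfolding compact_open_def P_def by (simp only: topology_inverse')
qed

lemma topspace_compact_open [simp]: "topspace compact_open = UNIV"
proof -
  have "openin compact_open (UNIV :: ('a \<Rightarrow> 'b) set)"
    unfolding openin_compact_open by (auto intro!: exI[of _ "{}"] exI[of _ 1])
  then show ?thesis using openin_subset by blast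
qed

lemma in_closure_of_compact_open:
  "f \<in> compact_open closure_of S \<longleftrightarrow>
    (\<forall>K e. compact K \<longrightarrow> 0 < e \<longrightarrow> (\<exists>g\<in>S. \<forall>x\<in>K. dist (g x) (f x) < e))"
proof (intro iffI allI impI)
  fix K :: "'a set" and e :: real
  assume f: "f \<in> compact_open closure_of S" and K: "compact K" and e: "0 < e"
  define U where "U = {g. \<exists>r<e. \<forall>x\<in>K. dist (g x) (f x) \<le> r}"
  have "openin compact_open U"
    unfolding openin_compact_open
  proof
    fix g assume "g \<in> U"
    then obtain r where r: "r < e" "\<forall>x\<in>K. dist (g x) (f x) \<le> r" unfolding U_def by blast
    define d where "d = (e - r) / 2"
    have d: "0 < d" "r + d < e" using r(1) by (auto simp: d_def field_simps)
    have "h \<in> U" if h: "\<forall>x\<in>K. dist (h x) (g x) < d" for h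
      unfolding U_def mem_Collect_eq
    proof (intro exI[of _ "r + d"] conjI ballI d(2))
      fix x assume x: "x \<in> K"
      show "dist (h x) (f x) \<le> r + d"
        using dist_triangle[of "h x" "f x" "g x"] bspec[OF r(2) x] bspec[OF h x] by linarith
    qed
    then show "\<exists>K e. compact K \<and> 0 < e \<and> {h. \<forall>x\<in>K. dist (h x) (g x) < e} \<subseteq> U"
      using K d(1) by (intro exI[of _ K] exI[of _ d]) auto
  qed
  moreover have "f \<in> U"
    unfolding U_def mem_Collect_eq by (rule exI[of _ 0]) (simp add: e)
  ultimately have "\<exists>g. g \<in> S \<and> g \<in> U" using f unfolding in_closure_of by simp
  then obtain g r where g: "g \<in> S" "r < e" "\<forall>x\<in>K. dist (g x) (f x) \<le> r" unfolding U_def by blast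
  show "\<exists>g\<in>S. \<forall>x\<in>K. dist (g x) (f x) < e"
  proof (rule bexI[OF _ g(1)], rule ballI)
    show "dist (g x) (f x) < e" if "x \<in> K" for x
      using g(2) bspec[OF g(3) that] by simp
  qed
next
  assume *: "\<forall>K e. compact K \<longrightarrow> 0 < e \<longrightarrow> (\<exists>g\<in>S. \<forall>x\<in>K. dist (g x) (f x) < e)"
  show "f \<in> compact_open closure_of S"
    unfolding in_closure_of
  proof (intro conjI allI impI)
    fix U assume "f \<in> U \<and> openin compact_open U"
    then obtain K e where K: "compact K" "0 < e" "{g. \<forall>x\<in>K. dist (g x) (f x) < e} \<subseteq> U"
      unfolding openin_compact_open by blast
    obtain g where "g \<in> S" "\<forall>x\<in>K. dist (g x) (f x) < e" using * K(1,2) by blast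
    then show "\<exists>y. y \<in> S \<and> y \<in> U" using K(3) by blast
  qed simp
qed

text \<open>
  The functional on the projective tensor product that corresponds to an operator \<open>T\<close> is
  determined by \<open>\<phi> \<otimes> m \<mapsto> \<langle>m, T \<phi>\<rangle>\<close>.
\<close>

definition lip_dual_functional ::
    "(('a::banach \<Rightarrow>\<^sub>L real) \<Rightarrow>\<^sub>L ('a, real) lip0) \<Rightarrow> ('a \<Rightarrow>\<^sub>L real, 'a free) ptensor \<Rightarrow>\<^sub>L real" where
  "lip_dual_functional T =
    (THE \<Phi>. \<forall>\<phi> m. blinfun_apply \<Phi> (ptensor_prod \<phi> m) = free_rep m (blinfun_apply T \<phi>))"

lemma lip_dual_functional_ex1:
  fixes T :: "('a::banach \<Rightarrow>\<^sub>L real) \<Rightarrow>\<^sub>L ('a, real) lip0"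
  shows "\<exists>!\<Phi>. \<forall>\<phi> m. blinfun_apply \<Phi> (ptensor_prod \<phi> m) = free_rep m (blinfun_apply T \<phi>)"
proof -
  have bl: "bounded_linear (\<lambda>\<phi>. lip_lin (T \<phi>))"
  proof (rule bounded_linear_intro)
    show "lip_lin (T (\<phi> + \<psi>)) = lip_lin (T \<phi>) + lip_lin (T \<psi>)"
      "lip_lin (T (c *\<^sub>R \<phi>)) = c *\<^sub>R lip_lin (T \<phi>)" for \<phi> \<psi> c
      by (rule free_blinfun_eqI; simp add: blinfun.bilinear_simps)+
    show "norm (lip_lin (T \<phi>)) \<le> norm \<phi> * norm T" for \<phi>
      using norm_blinfun[of T \<phi>] by (simp add: norm_lip_lin mult.commute)
  qed
  show ?thesis
    using ptensor_functional_ex1[of "Blinfun (\<lambda>\<phi>. lip_lin (T \<phi>))"]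
    by (simp add: bounded_linear_Blinfun_apply[OF bl] free_rep_lip_lin)
qed

text \<open>
  \<^const>\<open>strong_operator_topology\<close> on the dual of a normed space is the topology of pointwise
  convergence, that is, the weak-star topology.
\<close>

definition lip_dual_weak_star ::
    "(('a::banach \<Rightarrow>\<^sub>L real) \<Rightarrow>\<^sub>L ('a, real) lip0) topology" where
  "lip_dual_weak_star = pullback_topology UNIV lip_dual_functional strong_operator_topology"

section \<open>Operator ideals\<close>

text \<open>
  An operator ideal assigns sets of operators to all pairs of Banach spaces. Since HOL does not
  quantify over types, the Banach spaces are the closed linear subspaces of a Banach space \<open>'u\<close>
  that serves as a universe; \<open>'u\<close> may be taken so large that it contains isometric copies of any
  given set of Banach spaces (for finitely many: their product). The restriction to a universe
  loses nothing: every operator ideal on all Banach spaces restricts to one on \<open>'u\<close>, and every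
  one on \<open>'u\<close> arises in this way, from the finite sums of operators \<open>T \<circ> S \<circ> R\<close> with \<open>S\<close> in it.
  Operators between subspaces are functions on the domain, in the sense of
  \<^const>\<open>extensional\<close>.
\<close>

definition banach_subspace :: "'u::banach set \<Rightarrow> bool" where
  "banach_subspace E \<longleftrightarrow> subspace E \<and> closed E"

definition bounded_operators :: "'u::banach set \<Rightarrow> 'u set \<Rightarrow> ('u \<Rightarrow> 'u) set" where
  "bounded_operators E F = {T \<in> E \<rightarrow>\<^sub>E F.
     (\<forall>x\<in>E. \<forall>y\<in>E. T (x + y) = T x + T y) \<and> (\<forall>c. \<forall>x\<in>E. T (c *\<^sub>R x) = c *\<^sub>R T x) \<and>
     (\<exists>C. \<forall>x\<in>E. norm (T x) \<le> C * norm x)}"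

definition finite_rank_operators :: "'u::banach set \<Rightarrow> 'u set \<Rightarrow> ('u \<Rightarrow> 'u) set" where
  "finite_rank_operators E F = {T \<in> bounded_operators E F. \<exists>b. finite b \<and> T ` E \<subseteq> span b}"

definition operator_ideal :: "('u::banach set \<Rightarrow> 'u set \<Rightarrow> ('u \<Rightarrow> 'u) set) \<Rightarrow> bool" where
  "operator_ideal A \<longleftrightarrow>
     (\<forall>E F. banach_subspace E \<longrightarrow> banach_subspace F \<longrightarrow>
        A E F \<subseteq> bounded_operators E F \<and> finite_rank_operators E F \<subseteq> A E F \<and>
        (\<forall>S\<in>A E F. \<forall>T\<in>A E F. (\<lambda>x\<in>E. S x + T x) \<in> A E F) \<and>
        (\<forall>c. \<forall>T\<in>A E F. (\<lambda>x\<in>E. c *\<^sub>R T x) \<in> A E F)) \<and>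
     (\<forall>D E F G. banach_subspace D \<longrightarrow> banach_subspace E \<longrightarrow> banach_subspace F \<longrightarrow> banach_subspace G \<longrightarrow>
        (\<forall>R\<in>bounded_operators D E. \<forall>S\<in>A E F. \<forall>T\<in>bounded_operators F G.
           (\<lambda>x\<in>D. T (S (R x))) \<in> A D G))"

definition linear_isometry :: "('a::real_normed_vector \<Rightarrow> 'b::real_normed_vector) \<Rightarrow> bool" where
  "linear_isometry J \<longleftrightarrow> linear J \<and> (\<forall>x. norm (J x) = norm x)"

definition transport ::
    "('a::banach \<Rightarrow> 'u::banach) \<Rightarrow> ('b::banach \<Rightarrow> 'u) \<Rightarrow> ('a \<Rightarrow>\<^sub>L 'b) \<Rightarrow> 'u \<Rightarrow> 'u" where
  "transport J K T = (\<lambda>u\<in>range J. K (T (inv J u)))"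

text \<open>
  The operators between the Banach spaces \<open>'a\<close> and \<open>'b\<close> that belong to the ideal, via isometric
  copies of \<open>'a\<close> and \<open>'b\<close> in the universe. By the ideal property the choice of the copies
  does not matter: lemma \<open>ideal_ops_transport\<close>.
\<close>

definition ideal_ops ::
    "('u::banach set \<Rightarrow> 'u set \<Rightarrow> ('u \<Rightarrow> 'u) set) \<Rightarrow> ('a::banach \<Rightarrow>\<^sub>L 'b::banach) set" where
  "ideal_ops A = {T. \<exists>J K. linear_isometry J \<and> linear_isometry K \<and> transport J K T \<in> A (range J) (range K)}"

lemma linear_isometry_Pair:
  "linear_isometry (\<lambda>x :: 'a::real_normed_vector. (x, 0 :: 'b::real_normed_vector))"
  "linear_isometry (\<lambda>y :: 'b::real_normed_vector. (0 :: 'a::real_normed_vector, y))"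
  by (auto simp: linear_isometry_def norm_Pair intro!: linearI)

lemma linear_isometry_inj: "linear_isometry J \<Longrightarrow> inj J"
  by (auto simp: linear_isometry_def linear_injective_0) (metis norm_eq_zero)

lemma linear_isometry_range:
  fixes J :: "'a::banach \<Rightarrow> 'u::banach"
  assumes J: "linear_isometry J"
  shows "banach_subspace (range J)"
proof -
  have d: "dist (J x) (J y) = dist x y" for x y
    using J by (simp add: linear_isometry_def dist_norm flip: linear_diff)
  have "complete (range J)"
    using complete_isometric_image[of 1 UNIV J] J
    by (simp add: linear_isometry_def linear_conv_bounded_linear bounded_linear_intro[where K = 1]
        linear_add linear_scale complete_UNIV)
  then show ?thesis
    using J by (simp add: banach_subspace_def complete_imp_closed linear_isometry_def linear_subspace_image)
qed

lemma linear_isometry_change: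
  fixes J J' :: "'a::banach \<Rightarrow> 'u::banach"
  assumes J: "linear_isometry J" and J': "linear_isometry J'"
  shows "(\<lambda>u\<in>range J. J' (inv J u)) \<in> bounded_operators (range J) (range J')"
proof -
  note simps = linear_isometry_inj[OF J]
  have lin: "linear J" "linear J'" using J J' by (auto simp: linear_isometry_def)
  have add: "J x + J y = J (x + y)" and scale: "c *\<^sub>R J x = J (c *\<^sub>R x)" for x y c
    by (simp_all add: linear_add[OF lin(1)] linear_scale[OF lin(1)])
  show ?thesis
    unfolding bounded_operators_def
    using J J' by (auto simp: add scale inv_f_f[OF simps] linear_add[OF lin(2)] linear_scale[OF lin(2)]
        linear_isometry_def intro!: exI[of _ 1])
qed

lemma operator_ideal_compose:
  assumes "operator_ideal A" "banach_subspace D" "banach_subspace E" "banach_subspace F" "banach_subspace G"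
    and "R \<in> bounded_operators D E" "S \<in> A E F" "T \<in> bounded_operators F G"
  shows "(\<lambda>x\<in>D. T (S (R x))) \<in> A D G"
  using conjunct2[OF assms(1)[unfolded operator_ideal_def]] assms(2-) by simp

lemma ideal_ops_transport:
  fixes A :: "'u::banach set \<Rightarrow> 'u set \<Rightarrow> ('u \<Rightarrow> 'u) set" and T :: "'a::banach \<Rightarrow>\<^sub>L 'b::banach"
  assumes A: "operator_ideal A" and J: "linear_isometry J" and K: "linear_isometry K"
  shows "T \<in> ideal_ops A \<longleftrightarrow> transport J K T \<in> A (range J) (range K)"
proof
  assume "T \<in> ideal_ops A"
  then obtain J' K' where J': "linear_isometry J'" and K': "linear_isometry K'"
    and T: "transport J' K' T \<in> A (range J') (range K')"
    by (auto simp: ideal_ops_def)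
  have "(\<lambda>x\<in>range J. (\<lambda>u\<in>range K'. K (inv K' u)) (transport J' K' T ((\<lambda>u\<in>range J. J' (inv J u)) x)))
      \<in> A (range J) (range K)"
    by (rule operator_ideal_compose[OF A linear_isometry_range[OF J] linear_isometry_range[OF J']
          linear_isometry_range[OF K'] linear_isometry_range[OF K] linear_isometry_change[OF J J'] T
          linear_isometry_change[OF K' K]])
  moreover have "(\<lambda>x\<in>range J. (\<lambda>u\<in>range K'. K (inv K' u)) (transport J' K' T ((\<lambda>u\<in>range J. J' (inv J u)) x)))
      = transport J K T"
    by (auto simp: transport_def fun_eq_iff inv_f_f[OF linear_isometry_inj[OF J]]
        inv_f_f[OF linear_isometry_inj[OF J']] inv_f_f[OF linear_isometry_inj[OF K']])
  ultimately show "transport J K T \<in> A (range J) (range K)" by simp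
qed (use J K in \<open>auto simp: ideal_ops_def\<close>)

definition ideal_ball ::
    "('u::banach set \<Rightarrow> 'u set \<Rightarrow> ('u \<Rightarrow> 'u) set) \<Rightarrow> real \<Rightarrow> ('a::banach \<Rightarrow>\<^sub>L 'b::banach) set" where
  "ideal_ball A lam = {T \<in> ideal_ops A. norm T \<le> lam}"

definition lip_ideal ::
    "('u::banach set \<Rightarrow> 'u set \<Rightarrow> ('u \<Rightarrow> 'u) set) \<Rightarrow> ('a::banach, 'b::banach) lip0 set" where
  "lip_ideal A = {f. lip_lin f \<in> ideal_ops A}"

definition lip_ideal_ball ::
    "('u::banach set \<Rightarrow> 'u set \<Rightarrow> ('u \<Rightarrow> 'u) set) \<Rightarrow> real \<Rightarrow> ('a::banach, 'b::banach) lip0 set" where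
  "lip_ideal_ball A lam = {f \<in> lip_ideal A. norm f \<le> lam}"

lift_definition blinfun_adjoint ::
    "('a::real_normed_vector \<Rightarrow>\<^sub>L 'b::real_normed_vector) \<Rightarrow> ('b \<Rightarrow>\<^sub>L real) \<Rightarrow>\<^sub>L ('a \<Rightarrow>\<^sub>L real)"
  is "\<lambda>T \<phi>. \<phi> o\<^sub>L T"
  by (rule bounded_bilinear.bounded_linear_left[OF bounded_bilinear_blinfun_compose])

definition ideal_adjoint_ball ::
    "('u::banach set \<Rightarrow> 'u set \<Rightarrow> ('u \<Rightarrow> 'u) set) \<Rightarrow> real \<Rightarrow> (('b::banach \<Rightarrow>\<^sub>L real) \<Rightarrow>\<^sub>L ('a::banach \<Rightarrow>\<^sub>L real)) set" where
  "ideal_adjoint_ball A lam = blinfun_adjoint ` ideal_ball A lam"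

definition lip_adjoint_ball ::
    "('u::banach set \<Rightarrow> 'u set \<Rightarrow> ('u \<Rightarrow> 'u) set) \<Rightarrow> real \<Rightarrow> (('a::banach \<Rightarrow>\<^sub>L real) \<Rightarrow>\<^sub>L ('a, real) lip0) set" where
  "lip_adjoint_ball A lam = (\<lambda>S. free_dual_iso o\<^sub>L S) ` ideal_adjoint_ball A lam"

lemma lip_embed_dual_eq_adjoint: "lip_embed_dual = free_dual_iso o\<^sub>L blinfun_adjoint free_beta"
  by (rule blinfun_eqI, rule lip0_eqI)
    (simp add: free_dual_iso.rep_eq lip_embed_dual.rep_eq blinfun_adjoint.rep_eq)

definition lip_ideal_BAP ::
    "'a::banach itself \<Rightarrow> ('u::banach set \<Rightarrow> 'u set \<Rightarrow> ('u \<Rightarrow> 'u) set) \<Rightarrow> real \<Rightarrow> bool" where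
  "lip_ideal_BAP TYPE('a) A lam \<longleftrightarrow>
     (id :: 'a \<Rightarrow> 'a) \<in> compact_open closure_of (lip0_apply ` lip_ideal_ball A lam)"

end

theory Submission
  imports Defs
begin

text \<open>
  Write \<open>\<delta>\<close> for \<^const>\<open>free_delta\<close> and \<open>\<beta>\<close> for \<^const>\<open>free_beta\<close>, so that \<open>\<beta> (\<delta> x) = x\<close>. All
  approximants in the theorem are bounded by \<open>lam\<close> and hence equicontinuous. For equicontinuous
  linear operators, uniform approximation on compact sets is the same as approximation at finitely
  many points, and these points may be taken from a set with dense span.

  The linearization \<open>L\<close> of a Lipschitz map \<open>f\<close> satisfies \<open>L (\<delta> x) = f x\<close>. Hence \<open>f\<close> is close to the
  identity at finitely many points exactly if \<open>L\<close> is close to \<open>\<beta>\<close> at their images under \<open>\<delta>\<close>, which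
  span a dense subspace of the free space. Thus approximation of the identity by Lipschitz maps
  gives approximation of \<open>\<beta>\<close> by operators in the ideal (\<open>id_approx_imp_beta_linear_approx\<close>). Such an
  operator \<open>T\<close> is also a Lipschitz map with linearization \<open>T \<circ> \<beta>\<close>, where \<open>\<beta>\<close> is now that of
  the free space over the free space; this composition stays in the ideal
  (\<open>beta_linear_approx_imp_lip_approx\<close>). A Lipschitz map \<open>f\<close> on the free space that is close to
  \<open>\<beta>\<close> gives the map \<open>f \<circ> \<delta>\<close> close to \<open>\<beta> \<circ> \<delta>\<close>, the identity, and its linearization is the
  linearization of \<open>f\<close> composed with a linear operator (\<open>beta_lip_approx_imp_id_approx\<close>). This
  closes the circle through the first three properties.

  For the weak-star property, the functional on the projective tensor product that belongs to the
  adjoint of \<open>T\<close> sends \<open>\<phi> \<otimes> m\<close> to \<open>\<phi> (T m)\<close>, and the embedding of the dual is the adjoint of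
  \<open>\<beta>\<close>. By boundedness, weak-star approximation is therefore approximation of \<open>\<beta>\<close> in the weak
  operator topology. By the Hahn--Banach theorem a convex set has the same closure in the weak and
  in the strong operator topology (\<open>convex_weak_approximation_imp_strong\<close>), and the \<open>lam\<close>-ball of the
  ideal is convex (\<open>convex_ideal_ball\<close>).
\<close>

section \<open>Bounded nets of operators\<close>

text \<open>
  The filter is generated by the sets of the \<open>g \<in> S\<close> that approximate \<open>t\<close> up to \<open>e\<close> on \<open>Q\<close>.
  These sets are closed under finite intersections, and the hypothesis says that none is empty.
  All the closures below become statements about limits along such filters, which absorb the
  bookkeeping of finitely many points and finitely many tolerances.
\<close>
lemma pointwise_approximating_filter:
  fixes \<phi> :: "'i \<Rightarrow> 'x \<Rightarrow> 'm::metric_space"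
  assumes approx: "\<And>Q e. finite Q \<Longrightarrow> 0 < e \<Longrightarrow> \<exists>g\<in>S. \<forall>x\<in>Q. dist (\<phi> g x) (t x) < e"
  obtains F where "F \<noteq> bot" "\<forall>\<^sub>F g in F. g \<in> S" "\<And>x. ((\<lambda>g. \<phi> g x) \<longlongrightarrow> t x) F"
proof -
  define I where "I = {Q :: 'x set. finite Q} \<times> {0::real<..}"
  define N where "N = (\<lambda>(Q, e). {g \<in> S. \<forall>x\<in>Q. dist (\<phi> g x) (t x) < e})"
  define F where "F = (INF p\<in>I. principal (N p))"
  have ev: "eventually P F \<longleftrightarrow> (\<exists>p\<in>I. \<forall>g\<in>N p. P g)" for P
    unfolding F_def
  proof (subst eventually_INF_base)
    show "I \<noteq> {}" by (auto simp: I_def intro!: exI[of _ 1] exI[of _ "{}"])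
    fix p q assume "p \<in> I" "q \<in> I"
    then show "\<exists>r\<in>I. principal (N r) \<le> inf (principal (N p)) (principal (N q))"
      by (intro bexI[of _ "(fst p \<union> fst q, min (snd p) (snd q))"])
        (auto simp: I_def N_def)
  qed (simp add: eventually_principal)
  show thesis
  proof (rule that)
    show "F \<noteq> bot"
      unfolding trivial_limit_def ev using approx by (fastforce simp: I_def N_def)
    show "\<forall>\<^sub>F g in F. g \<in> S"
      unfolding ev by (rule bexI[of _ "({}, 1)"]) (auto simp: I_def N_def)
    show "((\<lambda>g. \<phi> g x) \<longlongrightarrow> t x) F" for x
    proof (rule tendstoI)
      fix e :: real assume "0 < e"
      then show "\<forall>\<^sub>F g in F. dist (\<phi> g x) (t x) < e"
        unfolding ev by (intro bexI[of _ "({x}, e)"]) (auto simp: I_def N_def)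
    qed
  qed
qed

text \<open>
  The equicontinuity of a bounded set of operators, in the form used to replace a point by a
  nearby one.
\<close>
lemma blinfun_dist_le:
  fixes T S :: "'a::real_normed_vector \<Rightarrow>\<^sub>L 'b::real_normed_vector"
  assumes "norm T \<le> M"
  shows "dist (T x) (S x) \<le> dist (T y) (S y) + (M + norm S) * dist x y"
proof -
  have "norm (T (x - y)) \<le> M * norm (x - y)"
    using norm_blinfun[of T "x - y"] mult_right_mono[OF assms norm_ge_zero[of "x - y"]] by simp
  moreover have "norm (S (x - y)) \<le> norm S * norm (x - y)" by (rule norm_blinfun)
  moreover have "T x - S x = (T y - S y) + (T (x - y) - S (x - y))"
    by (simp add: blinfun.diff_right)
  then have "norm (T x - S x) \<le> norm (T y - S y) + (norm (T (x - y)) + norm (S (x - y)))"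
    using norm_triangle_ineq[of "T y - S y" "T (x - y) - S (x - y)"]
      norm_triangle_ineq4[of "T (x - y)" "S (x - y)"] by simp
  ultimately show ?thesis by (simp add: dist_norm algebra_simps)
qed

text \<open>
  Linearity gives convergence on the span, and equicontinuity gives it on the closure. The lemma
  is used twice: for the operators on the free space, where the evaluations \<open>free_delta x\<close> span a
  dense subspace, and for the functionals on the projective tensor product, where the elementary
  tensors do.
\<close>
lemma bounded_net_converges_on_closed_span:
  fixes \<Phi> :: "'i \<Rightarrow> 'a::real_normed_vector \<Rightarrow>\<^sub>L 'b::real_normed_vector"
    and \<Psi> :: "'a \<Rightarrow>\<^sub>L 'b"
  assumes bd: "\<forall>\<^sub>F i in F. norm (\<Phi> i) \<le> M"
    and conv: "\<And>x. x \<in> D \<Longrightarrow> ((\<lambda>i. \<Phi> i x) \<longlongrightarrow> \<Psi> x) F"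
    and x: "x \<in> closure (span D)"
  shows "((\<lambda>i. \<Phi> i x) \<longlongrightarrow> \<Psi> x) F"
proof -
  have sp: "((\<lambda>i. \<Phi> i y) \<longlongrightarrow> \<Psi> y) F" if "y \<in> span D" for y
    using that
  proof (induction rule: span_induct_alt)
    case base
    show ?case by (simp add: blinfun.zero_right)
  next
    case (step c s v)
    then show ?case by (auto simp: blinfun.bilinear_simps intro!: tendsto_intros conv)
  qed
  show ?thesis
  proof (rule tendstoI)
    fix e :: real assume e: "0 < e"
    define B where "B = \<bar>M\<bar> + norm \<Psi> + 1"
    have B: "0 < B" by (simp add: B_def add_nonneg_pos)
    obtain y where y: "y \<in> span D" "dist y x < e / 2 / B"
      using x e B unfolding closure_approachable by (meson divide_pos_pos half_gt_zero)
    have "\<forall>\<^sub>F i in F. dist (\<Phi> i y) (\<Psi> y) < e / 2"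
      using sp[OF y(1)] e by (intro tendstoD) auto
    then show "\<forall>\<^sub>F i in F. dist (\<Phi> i x) (\<Psi> x) < e"
      using bd
    proof eventually_elim
      case (elim i)
      have "(M + norm \<Psi>) * dist x y \<le> B * dist x y"
        by (intro mult_right_mono) (auto simp: B_def)
      also have "\<dots> < e / 2"
        using y(2) B by (simp add: pos_less_divide_eq dist_commute mult_ac)
      finally show ?case
        using blinfun_dist_le[OF elim(2), of x \<Psi> y] elim(1) by linarith
    qed
  qed
qed

text \<open>
  A compact set lies in finitely many balls of a radius at which equicontinuity costs at most
  \<open>e / 2\<close>; at the finitely many centres convergence is uniform.
\<close>
lemma bounded_net_converges_uniformly_on_compact:
  fixes \<Phi> :: "'i \<Rightarrow> 'a::real_normed_vector \<Rightarrow>\<^sub>L 'b::real_normed_vector"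
    and \<Psi> :: "'a \<Rightarrow>\<^sub>L 'b"
  assumes bd: "\<forall>\<^sub>F i in F. norm (\<Phi> i) \<le> M"
    and conv: "\<And>x. x \<in> K \<Longrightarrow> ((\<lambda>i. \<Phi> i x) \<longlongrightarrow> \<Psi> x) F"
    and K: "compact K" and e: "0 < e"
  shows "\<forall>\<^sub>F i in F. \<forall>x\<in>K. dist (\<Phi> i x) (\<Psi> x) < e"
proof -
  define B where "B = \<bar>M\<bar> + norm \<Psi> + 1"
  have B: "0 < B" by (simp add: B_def add_nonneg_pos)
  obtain Q where Q: "finite Q" "Q \<subseteq> K" "K \<subseteq> (\<Union>q\<in>Q. ball q (e / 2 / B))"
    using seq_compact_imp_totally_bounded[OF compact_imp_seq_compact[OF K]] e B
    by (meson divide_pos_pos half_gt_zero)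
  have "\<forall>\<^sub>F i in F. \<forall>q\<in>Q. dist (\<Phi> i q) (\<Psi> q) < e / 2"
    using Q e by (intro eventually_ball_finite ballI tendstoD conv) auto
  then show ?thesis
    using bd
  proof eventually_elim
    case (elim i)
    show ?case
    proof
      fix x assume "x \<in> K"
      then obtain y where y: "y \<in> Q" "dist y x < e / 2 / B" using Q(3) by auto
      have "(M + norm \<Psi>) * dist x y \<le> B * dist x y"
        by (intro mult_right_mono) (auto simp: B_def)
      also have "\<dots> < e / 2"
        using y(2) B by (simp add: pos_less_divide_eq dist_commute mult_ac)
      finally show "dist (\<Phi> i x) (\<Psi> x) < e"
        using blinfun_dist_le[OF elim(2), of x \<Psi> y] bspec[OF elim(1) y(1)] by linarith
    qed
  qed
qed

section \<open>Weak and strong approximation by convex sets of operators\<close>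

text \<open>
  The functional comes from the sublinear functional \<open>q\<close>, the infimum over \<open>t \<ge> 0\<close> and \<open>c \<in> C\<close> of
  \<open>norm (x + t *\<^sub>R (v - c)) - t * e\<close>. The distance of \<open>v\<close> from \<open>C\<close> bounds \<open>q x\<close> below by \<open>- norm x\<close>,
  and convexity of \<open>C\<close> makes \<open>q\<close> subadditive. A linear functional below \<open>q\<close> is bounded because of
  the terms with \<open>t = 0\<close>, and the terms with \<open>t = 1\<close> give its value at most \<open>- e\<close> on \<open>c - v\<close>.
\<close>
lemma convex_point_separation:
  fixes C :: "'v::real_normed_vector set"
  assumes C: "convex C" and e: "0 < e" and far: "\<And>c. c \<in> C \<Longrightarrow> e \<le> norm (v - c)"
  obtains \<phi> :: "'v \<Rightarrow>\<^sub>L real" where "\<And>c. c \<in> C \<Longrightarrow> \<phi> c + e \<le> \<phi> v"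
proof (cases "C = {}")
  case True
  then show thesis using that by blast
next
  case False
  define I where "I = {0::real..} \<times> C"
  define k where "k x = (\<lambda>(t, c). norm (x + t *\<^sub>R (v - c)) - t * e)" for x
  define q where "q x = (INF i\<in>I. k x i)" for x
  have ne: "I \<noteq> {}" using False by (auto simp: I_def)
  have low: "- norm x \<le> k x i" if "i \<in> I" for x i
  proof -
    from that obtain t c where i: "i = (t, c)" "0 \<le> t" "c \<in> C" by (auto simp: I_def)
    have "t * e \<le> norm (t *\<^sub>R (v - c))" using i far by (simp add: mult_left_mono)
    also have "\<dots> \<le> norm (x + t *\<^sub>R (v - c)) + norm x"
      using norm_triangle_ineq4[of "x + t *\<^sub>R (v - c)" x] by simp
    finally show ?thesis by (simp add: i k_def)
  qed
  have bdd: "bdd_below (k x ` I)" for x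
    using low by (intro bdd_belowI2)
  have q_le: "q x \<le> norm (x + t *\<^sub>R (v - c)) - t * e" if "0 \<le> t" "c \<in> C" for x c and t :: real
    using cINF_lower[OF bdd, of "(t, c)" x] that by (auto simp: q_def k_def I_def)
  have q_ge: "b \<le> q x" if "\<And>t c. 0 \<le> t \<Longrightarrow> c \<in> C \<Longrightarrow> b \<le> norm (x + t *\<^sub>R (v - c)) - t * e" for x and b :: real
    unfolding q_def using that by (intro cINF_greatest[OF ne]) (auto simp: I_def k_def)
  have add: "q (x + y) \<le> q x + q y" for x y
  proof -
    have *: "q (x + y) \<le> (norm (x + t *\<^sub>R (v - c)) - t * e) + (norm (y + s *\<^sub>R (v - d)) - s * e)"
      if tc: "0 \<le> t" "c \<in> C" and sd: "0 \<le> s" "d \<in> C" for c d and t s :: real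
    proof (cases "t + s = 0")
      case True
      then have "t = 0" "s = 0" using tc sd by auto
      then show ?thesis
        using q_le[of 0 c "x + y"] tc norm_triangle_ineq[of x y] by simp
    next
      case False
      then have pos: "0 < t + s" using tc sd by simp
      define b where "b = (t / (t + s)) *\<^sub>R c + (s / (t + s)) *\<^sub>R d"
      have "b \<in> C"
        unfolding b_def using pos tc sd
        by (intro convexD[OF C]) (auto simp flip: add_divide_distrib)
      then have "q (x + y) \<le> norm ((x + y) + (t + s) *\<^sub>R (v - b)) - (t + s) * e"
        using pos by (intro q_le) auto
      also have "(t + s) *\<^sub>R b = t *\<^sub>R c + s *\<^sub>R d"
        using pos by (simp add: b_def scaleR_add_right)
      then have "(x + y) + (t + s) *\<^sub>R (v - b) = (x + t *\<^sub>R (v - c)) + (y + s *\<^sub>R (v - d))"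
        by (simp add: algebra_simps)
      finally show ?thesis
        using norm_triangle_ineq[of "x + t *\<^sub>R (v - c)" "y + s *\<^sub>R (v - d)"]
        by (simp add: algebra_simps)
    qed
    have "q (x + y) - (norm (y + s *\<^sub>R (v - d)) - s * e) \<le> q x" if "0 \<le> s" "d \<in> C" for d and s :: real
      using *[OF _ _ that] by (intro q_ge) (simp add: algebra_simps)
    then have "q (x + y) - q x \<le> q y"
      by (intro q_ge) (simp add: algebra_simps)
    then show ?thesis by simp
  qed
  have sc1: "q (r *\<^sub>R x) \<le> r * q x" if r: "0 < r" for x and r :: real
  proof -
    have "q (r *\<^sub>R x) / r \<le> q x"
    proof (rule q_ge)
      fix t :: real and c assume tc: "0 \<le> t" "c \<in> C"
      have "q (r *\<^sub>R x) \<le> norm (r *\<^sub>R x + (r * t) *\<^sub>R (v - c)) - (r * t) * e"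
        using r tc by (intro q_le) auto
      also have "r *\<^sub>R x + (r * t) *\<^sub>R (v - c) = r *\<^sub>R (x + t *\<^sub>R (v - c))"
        by (simp add: algebra_simps)
      finally have "q (r *\<^sub>R x) \<le> r * (norm (x + t *\<^sub>R (v - c)) - t * e)"
        using r by (simp add: right_diff_distrib mult.assoc)
      then show "q (r *\<^sub>R x) / r \<le> norm (x + t *\<^sub>R (v - c)) - t * e"
        using r by (simp add: pos_divide_le_eq mult.commute)
    qed
    then show ?thesis using r by (simp add: pos_divide_le_eq mult.commute)
  qed
  have sc: "q (r *\<^sub>R x) = r * q x" if r: "0 < r" for x and r :: real
  proof (rule antisym[OF sc1[OF r]])
    have "q (inverse r *\<^sub>R (r *\<^sub>R x)) \<le> inverse r * q (r *\<^sub>R x)" using r by (intro sc1) auto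
    then show "r * q x \<le> q (r *\<^sub>R x)" using r by (simp add: field_simps)
  qed
  have "sublinear q" using add sc by (auto simp: sublinear_def)
  then obtain f where f: "linear f" "\<And>x. f x \<le> q x" using sublinear_minimal by metis
  obtain c0 where "c0 \<in> C" using False by blast
  then have up: "f x \<le> norm x" for x using f(2)[of x] q_le[of 0 c0 x] by simp
  have ab: "norm (f x) \<le> norm x * 1" for x
    using up[of x] up[of "- x"] by (simp add: linear_neg[OF f(1)])
  have bl: "bounded_linear f"
    using f(1) ab by (intro bounded_linear_intro[where K = 1])
      (auto simp: linear_add linear_scale)
  show thesis
  proof (rule that[of "Blinfun f"])
    fix c assume c: "c \<in> C"
    have "f (c - v) \<le> - e" using f(2)[of "c - v"] q_le[of 1 c "c - v"] c by simp
    then show "Blinfun f c + e \<le> Blinfun f v"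
      by (simp add: bounded_linear_Blinfun_apply[OF bl] linear_diff[OF f(1)])
  qed
qed

text \<open>
  A convex set of operators has the same closure in the weak and in the strong operator topology,
  here for a fixed finite set \<open>Q\<close> of points. If no \<open>T \<in> C\<close> is close to \<open>S\<close> on \<open>Q\<close>, then the tuple
  \<open>(S x)\<close> indexed by \<open>x \<in> Q\<close> is far from the convex set of the tuples \<open>(T x)\<close>; a functional that
  separates them is a sum of functionals \<open>\<psi> x\<close> on the coordinates, and contradicts the weak
  approximation.
\<close>
lemma convex_weak_approximation_imp_strong:
  fixes C :: "('a::real_normed_vector \<Rightarrow>\<^sub>L 'b::real_normed_vector) set" and S :: "'a \<Rightarrow>\<^sub>L 'b"
  assumes C: "convex C"
    and weak: "\<And>\<psi> :: 'a \<Rightarrow> 'b \<Rightarrow>\<^sub>L real. \<And>e. 0 < e \<Longrightarrow> \<exists>T\<in>C. \<bar>\<Sum>x\<in>Q. \<psi> x (T x - S x)\<bar> < e"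
    and Q: "finite Q" and e: "0 < e"
  shows "\<exists>T\<in>C. \<forall>x\<in>Q. dist (blinfun_apply T x) (blinfun_apply S x) < e"
proof (rule ccontr)
  assume no: "\<not> ?thesis"
  obtain n :: nat and m where m: "Q = m ` {..<n}" "inj_on m {..<n}"
    using finite_imp_nat_seg_image_inj_on[OF Q] by (auto simp: lessThan_def)
  \<comment> \<open>The finite power of \<open>'b\<close> that holds the tuples is realised inside the bounded functions on
     \<open>nat\<close>, all of which are continuous: tuples are extended by \<open>0\<close>.\<close>
  define pad :: "(nat \<Rightarrow> 'b) \<Rightarrow> nat \<Rightarrow>\<^sub>C 'b"
    where "pad f = Bcontfun (\<lambda>j. if j < n then f j else 0)" for f
  have pad: "apply_bcontfun (pad f) j = (if j < n then f j else 0)" for f j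
  proof -
    have "range (\<lambda>j. if j < n then f j else 0) \<subseteq> insert 0 (f ` {..<n})" by auto
    then have "bounded (range (\<lambda>j. if j < n then f j else 0))"
      by (meson bounded_subset finite_imp_bounded finite_imageI finite_insert finite_lessThan)
    then show ?thesis
      unfolding pad_def by (subst Bcontfun_inverse) (auto simp: bcontfun_def)
  qed
  define vec where "vec T = pad (\<lambda>j. blinfun_apply T (m j))" for T :: "'a \<Rightarrow>\<^sub>L 'b"
  have lin: "linear vec"
    by (rule linearI; rule bcontfun_eqI) (auto simp: vec_def pad blinfun.bilinear_simps)
  have far: "e \<le> norm (vec S - v)" if "v \<in> vec ` C" for v
  proof -
    from that obtain T where T: "T \<in> C" "v = vec T" by blast
    then obtain j where j: "j < n" "e \<le> dist (T (m j)) (S (m j))"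
      using no m(1) by (auto simp: not_less)
    have "dist (T (m j)) (S (m j)) = norm (apply_bcontfun (vec S - v) j)"
      using j(1) by (simp add: T vec_def pad dist_norm norm_minus_commute)
    then show ?thesis using j(2) norm_bounded[of "vec S - v" j] by simp
  qed
  obtain \<phi> where \<phi>: "\<And>v. v \<in> vec ` C \<Longrightarrow> blinfun_apply \<phi> v + e \<le> \<phi> (vec S)"
    using convex_point_separation[OF convex_linear_image[OF lin C] e far] by blast
  define single where "single j y = pad (\<lambda>i. if i = j then y else 0)" for j y
  have bl: "bounded_linear (\<lambda>y. \<phi> (single j y))" for j
  proof (rule bounded_linear_compose[OF blinfun.bounded_linear_right], rule bounded_linear_intro)
    show "norm (single j y) \<le> norm y * 1" for y
      by (rule norm_bound) (simp add: single_def pad)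
  qed (rule bcontfun_eqI; simp add: single_def pad)+
  define \<psi> where "\<psi> x = Blinfun (\<lambda>y. \<phi> (single (the_inv_into {..<n} m x) y))" for x
  have apply_sum: "apply_bcontfun (sum g J) i = (\<Sum>j\<in>J. apply_bcontfun (g j) i)"
    for g :: "nat \<Rightarrow> nat \<Rightarrow>\<^sub>C 'b" and J i
    by (induction J rule: infinite_finite_induct) auto
  have vec_eq: "vec T = (\<Sum>j<n. single j (T (m j)))" for T :: "'a \<Rightarrow>\<^sub>L 'b"
    by (rule bcontfun_eqI) (simp add: vec_def apply_sum single_def pad)
  have rep: "(\<Sum>x\<in>Q. \<psi> x (T x)) = \<phi> (vec T)" for T :: "'a \<Rightarrow>\<^sub>L 'b"
  proof -
    have "(\<Sum>x\<in>Q. \<psi> x (T x)) = (\<Sum>j<n. \<psi> (m j) (T (m j)))"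
      unfolding m(1) by (simp add: sum.reindex[OF m(2)])
    also have "\<dots> = (\<Sum>j<n. \<phi> (single j (T (m j))))"
      using m(2) by (intro sum.cong)
        (auto simp: \<psi>_def bounded_linear_Blinfun_apply[OF bl] the_inv_into_f_f)
    finally show ?thesis by (simp add: vec_eq blinfun.sum_right)
  qed
  obtain T where T: "T \<in> C" "\<bar>\<Sum>x\<in>Q. \<psi> x (T x - S x)\<bar> < e" using weak[OF e, of \<psi>] by blast
  have "(\<Sum>x\<in>Q. \<psi> x (T x - S x)) = \<phi> (vec T) - \<phi> (vec S)"
    by (simp add: blinfun.diff_right sum_subtractf rep)
  then show False using T(2) \<phi>[of "vec T"] T(1) by simp
qed

section \<open>Functionals on the projective tensor product\<close>

lemma lip_dual_functional_prod:
  "lip_dual_functional T (ptensor_prod \<phi> m) = free_rep m (T \<phi>)"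
  using theI'[OF lip_dual_functional_ex1, of T] by (simp add: lip_dual_functional_def)

text \<open>
  Every representation of a tensor as a sum of elementary tensors gives the bound
  \<open>norm T * tensor_cost xs\<close>, and the projective norm is the infimum of the costs. The bound passes
  to the completion by density.
\<close>
lemma norm_lip_dual_functional_le: "norm (lip_dual_functional T) \<le> norm T"
proof (rule norm_blinfun_bound)
  fix z
  let ?K = "{z. norm (lip_dual_functional T z) \<le> norm T * norm z}"
  have "range to_completion \<subseteq> ?K"
  proof safe
    fix u :: "('a \<Rightarrow>\<^sub>L real, 'a free) tensor"
    have sum: "norm (lip_dual_functional T (to_completion (tensor_sum xs))) \<le> norm T * tensor_cost xs" for xs
    proof (induction xs)
      case Nil
      show ?case by (simp add: linear_0[OF to_completion_linear] blinfun.zero_right)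
    next
      case (Cons p xs)
      obtain \<phi> m where p: "p = (\<phi>, m)" by (cases p)
      have "\<bar>free_rep m (T \<phi>)\<bar> \<le> norm m * norm (T \<phi>)"
        using norm_blinfun[of "free_rep m" "T \<phi>"] by simp
      also have "\<dots> \<le> norm m * (norm T * norm \<phi>)"
        by (intro mult_left_mono norm_blinfun) simp
      finally have "\<bar>free_rep m (T \<phi>)\<bar> \<le> norm T * (norm \<phi> * norm m)" by (simp add: mult_ac)
      moreover have "lip_dual_functional T (to_completion (tensor_sum (p # xs)))
          = free_rep m (T \<phi>) + lip_dual_functional T (to_completion (tensor_sum xs))"
        by (simp add: p linear_add[OF to_completion_linear] blinfun.add_right
            lip_dual_functional_prod flip: ptensor_prod_def)
      ultimately show ?case using Cons by (simp add: p distrib_left)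
    qed
    show "norm (lip_dual_functional T (to_completion u)) \<le> norm T * norm (to_completion u)"
    proof (cases "norm T = 0")
      case True
      obtain xs where "u = tensor_sum xs" using tensor_sum_ex[of u] by (rule exE)
      then show ?thesis using sum[of xs] True by simp
    next
      case False
      have "norm (lip_dual_functional T (to_completion u)) / norm T \<le> norm u"
        by (rule norm_tensor_greatest)
          (use sum False in \<open>simp add: pos_divide_le_eq mult.commute\<close>)
      then show ?thesis using False by (simp add: pos_divide_le_eq mult.commute)
    qed
  qed
  moreover have "closed ?K"
    by (intro closed_Collect_le continuous_intros linear_continuous_on blinfun.bounded_linear_right)
  ultimately have "closure (range to_completion) \<subseteq> ?K" by (rule closure_minimal)
  then show "norm (lip_dual_functional T z) \<le> norm T * norm z"
    unfolding to_completion_dense by blast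
qed simp

lemma closure_span_ptensor_prod:
  "closure (span (range (\<lambda>(x, y). ptensor_prod x y))) = (UNIV :: ('a::real_normed_vector, 'b::real_normed_vector) ptensor set)"
proof -
  let ?D = "range (\<lambda>(x, y). ptensor_prod x y) :: ('a, 'b) ptensor set"
  have "z \<in> closure (span ?D)" for z
  proof (rule completion_induct[OF subspace_closure[OF subspace_span] closed_closure])
    fix u :: "('a, 'b) tensor"
    have "to_completion (tensor_sum xs) \<in> span ?D" for xs :: "('a \<times> 'b) list"
    proof (induction xs)
      case Nil
      show ?case by (simp add: linear_0[OF to_completion_linear] span_zero)
    next
      case (Cons p xs)
      obtain x y where p: "p = (x, y)" by (cases p)
      have "ptensor_prod x y \<in> span ?D" by (rule span_base) auto
      then show ?case
        using Cons by (simp add: p linear_add[OF to_completion_linear] span_add flip: ptensor_prod_def)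
    qed
    moreover obtain xs where "u = tensor_sum xs" using tensor_sum_ex[of u] by (rule exE)
    ultimately show "to_completion u \<in> closure (span ?D)" using closure_subset by blast
  qed
  then show ?thesis by blast
qed

lemma closure_span_free_delta: "closure (span (range free_delta)) = UNIV"
proof -
  have "m \<in> closure (span (range free_delta))" for m :: "'a free"
    by (rule free_induct[OF subspace_closure[OF subspace_span] closed_closure])
      (intro subsetD[OF closure_subset] span_base rangeI)
  then show ?thesis by blast
qed

text \<open>
  Approximation at a single element \<open>u\<close> of the tensor product is all that is needed from the
  weak-star closure: by linearity, one \<open>u\<close> encodes any finite number of elementary tensors.
\<close>
lemma lip_dual_weak_star_closure_approx:
  assumes "T \<in> lip_dual_weak_star closure_of S" and e: "0 < e"
  obtains R where "R \<in> S" "dist (lip_dual_functional T u) (lip_dual_functional R u) < e"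
proof -
  let ?U = "{R \<in> topspace lip_dual_weak_star. lip_dual_functional R u \<in> ball (lip_dual_functional T u) e}"
  have "continuous_map lip_dual_weak_star euclidean ((\<lambda>\<Phi>. blinfun_apply \<Phi> u) \<circ> lip_dual_functional)"
    unfolding lip_dual_weak_star_def
    by (rule continuous_map_pullback[OF strong_operator_topology_continuous_evaluation])
  then have "openin lip_dual_weak_star ?U"
    unfolding comp_def by (rule openin_continuous_map_preimage) simp
  moreover have "T \<in> ?U"
    using assms by (simp add: in_closure_of)
  ultimately have "\<exists>R. R \<in> S \<and> R \<in> ?U"
    using assms(1)[unfolded in_closure_of, THEN conjunct2, THEN spec, of ?U] by (elim mp) (rule conjI)
  then obtain R where R: "R \<in> S" "R \<in> ?U" by (elim exE conjE)
  from R(2) have "dist (lip_dual_functional T u) (lip_dual_functional R u) < e"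
    by (simp only: mem_Collect_eq mem_ball)
  with R(1) show thesis by (rule that)
qed

lemma lip_dual_weak_star_closure_filterI:
  assumes F: "F \<noteq> bot" "\<forall>\<^sub>F i in F. g i \<in> S"
    and lim: "\<And>u. ((\<lambda>i. lip_dual_functional (g i) u) \<longlongrightarrow> lip_dual_functional T u) F"
  shows "T \<in> lip_dual_weak_star closure_of S"
  unfolding in_closure_of
proof (intro conjI allI impI)
  show "T \<in> topspace lip_dual_weak_star"
    by (simp add: lip_dual_weak_star_def topspace_pullback_topology strong_operator_topology_topspace)
  fix U assume U: "T \<in> U \<and> openin lip_dual_weak_star U"
  then obtain V where V: "open V" "U = (\<lambda>R. blinfun_apply (lip_dual_functional R)) -` V"
    by (auto simp: lip_dual_weak_star_def strong_operator_topology_def openin_pullback_topology)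
  have "limitin (product_topology (\<lambda>_. euclidean) UNIV) (\<lambda>i. blinfun_apply (lip_dual_functional (g i)))
      (blinfun_apply (lip_dual_functional T)) F"
    unfolding limitin_componentwise using lim by simp
  then have "((\<lambda>i. blinfun_apply (lip_dual_functional (g i))) \<longlongrightarrow> blinfun_apply (lip_dual_functional T)) F"
    by (simp add: euclidean_product_topology)
  then have "\<forall>\<^sub>F i in F. g i \<in> U"
    using topological_tendstoD[OF _ V(1)] U V(2) by fastforce
  then have "\<forall>\<^sub>F i in F. g i \<in> S \<and> g i \<in> U" using F(2) by eventually_elim simp
  then show "\<exists>R. R \<in> S \<and> R \<in> U" using eventually_happens' F(1) by blast
qed

section \<open>Operator ideals\<close>

lemma transport_apply: "linear_isometry J \<Longrightarrow> transport J K T (J x) = K (T x)"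
  by (simp add: transport_def inv_f_f[OF linear_isometry_inj])

lemma transport_bounded_operator:
  assumes J: "linear_isometry J" and K: "linear_isometry K"
  shows "transport J K T \<in> bounded_operators (range J) (range K)"
proof -
  have lin: "linear J" "linear K" using J K by (auto simp: linear_isometry_def)
  have nJ: "norm (J x) = norm x" and nK: "norm (K y) = norm y" for x y
    using J K by (auto simp: linear_isometry_def)
  have add: "J x + J y = J (x + y)" and scale: "c *\<^sub>R J x = J (c *\<^sub>R x)" for x y c
    by (simp_all add: linear_add[OF lin(1)] linear_scale[OF lin(1)])
  have "transport J K T \<in> range J \<rightarrow>\<^sub>E range K"
    by (auto simp: transport_def)
  then show ?thesis
    unfolding bounded_operators_def
    by (auto simp: add scale transport_apply[OF J] linear_add[OF lin(2)] linear_scale[OF lin(2)]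
        blinfun.bilinear_simps nJ nK intro: norm_blinfun)
qed

text \<open>
  The ideal property for the typed operators. The copies of \<open>'b\<close> and \<open>'c\<close> in the universe come
  with \<open>T \<in> ideal_ops A\<close>, whereas the domain \<open>'a\<close> need not embed into either of them; its copy is
  given by \<open>J\<close>. The left factor of the composition is the identity of the copy of \<open>'c\<close>.
\<close>
lemma ideal_ops_compose_right:
  fixes A :: "'u::banach set \<Rightarrow> 'u set \<Rightarrow> ('u \<Rightarrow> 'u) set"
    and T :: "'b::banach \<Rightarrow>\<^sub>L 'c::banach" and R :: "'a::banach \<Rightarrow>\<^sub>L 'b" and J :: "'a \<Rightarrow> 'u"
  assumes A: "operator_ideal A" and J: "linear_isometry J" and T: "T \<in> ideal_ops A"
  shows "T o\<^sub>L R \<in> ideal_ops A"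
proof -
  from T obtain J' K where J': "linear_isometry J'" and K: "linear_isometry K"
    and TA: "transport J' K T \<in> A (range J') (range K)"
    by (auto simp: ideal_ops_def)
  let ?id = "transport K K id_blinfun"
  have "(\<lambda>x\<in>range J. ?id (transport J' K T (transport J J' R x))) \<in> A (range J) (range K)"
    by (rule operator_ideal_compose[OF A linear_isometry_range[OF J] linear_isometry_range[OF J']
          linear_isometry_range[OF K] linear_isometry_range[OF K] transport_bounded_operator[OF J J'] TA
          transport_bounded_operator[OF K K]])
  also have "(\<lambda>x\<in>range J. ?id (transport J' K T (transport J J' R x))) = transport J K (T o\<^sub>L R)"
    by (rule ext) (auto simp: transport_apply[OF J] transport_apply[OF J'] transport_apply[OF K]
        restrict_def, auto simp: transport_def)
  finally show ?thesis using J K by (auto simp: ideal_ops_def)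
qed

text \<open>
  Membership in \<open>ideal_ops A\<close> may be tested with one fixed pair of copies \<open>J\<close> and \<open>K\<close>, by
  \<open>ideal_ops_transport\<close>; for fixed copies, transport to the universe is linear in the operator.
\<close>
lemma convex_ideal_ball:
  fixes A :: "'u::banach set \<Rightarrow> 'u set \<Rightarrow> ('u \<Rightarrow> 'u) set" and J :: "'a::banach \<Rightarrow> 'u" and K :: "'b::banach \<Rightarrow> 'u"
  assumes A: "operator_ideal A" and J: "linear_isometry J" and K: "linear_isometry K"
  shows "convex (ideal_ball A lam :: ('a \<Rightarrow>\<^sub>L 'b) set)"
proof (rule convexI)
  fix S T :: "'a \<Rightarrow>\<^sub>L 'b" and s t :: real
  assume ST: "S \<in> ideal_ball A lam" "T \<in> ideal_ball A lam" and st: "0 \<le> s" "0 \<le> t" "s + t = 1"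
  note ops = ideal_ops_transport[OF A J K]
  note closed = A[unfolded operator_ideal_def, THEN conjunct1, rule_format,
      OF linear_isometry_range[OF J] linear_isometry_range[OF K]]
  have scale: "c *\<^sub>R U \<in> ideal_ops A" if "U \<in> ideal_ops A" for c and U :: "'a \<Rightarrow>\<^sub>L 'b"
  proof -
    have "(\<lambda>x\<in>range J. c *\<^sub>R transport J K U x) \<in> A (range J) (range K)"
      using that closed unfolding ops by blast
    also have "(\<lambda>x\<in>range J. c *\<^sub>R transport J K U x) = transport J K (c *\<^sub>R U)"
      using K by (auto simp: transport_def linear_isometry_def linear_scale blinfun.scaleR_left)
    finally show ?thesis unfolding ops .
  qed
  have add: "U + V \<in> ideal_ops A" if "U \<in> ideal_ops A" "V \<in> ideal_ops A" for U V :: "'a \<Rightarrow>\<^sub>L 'b"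
  proof -
    have "(\<lambda>x\<in>range J. transport J K U x + transport J K V x) \<in> A (range J) (range K)"
      using that closed unfolding ops by blast
    also have "(\<lambda>x\<in>range J. transport J K U x + transport J K V x) = transport J K (U + V)"
      using K by (auto simp: transport_def linear_isometry_def linear_add blinfun.add_left)
    finally show ?thesis unfolding ops .
  qed
  have "norm (s *\<^sub>R S + t *\<^sub>R T) \<le> lam"
    using convexD[OF convex_cball, of S 0 lam T s t] ST st by (simp add: ideal_ball_def)
  then show "s *\<^sub>R S + t *\<^sub>R T \<in> ideal_ball A lam"
    using ST by (simp add: ideal_ball_def add scale)
qed

section \<open>Linearization of Lipschitz maps\<close>

text \<open>
  For a linear operator the linearization factors through the barycentre map. This is how a member
  of the ideal, seen as a Lipschitz map, stays in the ideal.
\<close>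
lemma lip_lin_lip_of_blinfun: "lip_lin (lip_of_blinfun T) = T o\<^sub>L free_beta"
  by (rule free_blinfun_eqI) simp

text \<open>
  Precomposition with a Lipschitz map becomes composition with a linear operator after
  linearization. Here \<open>lip_of_free id_blinfun\<close> is \<open>free_delta\<close> as a Lipschitz map.
\<close>
lemma lip_lin_compose:
  "lip_lin (lip0_compose f h) = lip_lin f o\<^sub>L lip_lin (lip0_compose (lip_of_free id_blinfun) h)"
  by (rule free_blinfun_eqI) simp

lemma norm_lip0_compose_le: "norm (lip0_compose f h) \<le> norm f * norm h"
proof (rule lip0_norm_le)
  fix x y
  have "norm (f (h x) - f (h y)) \<le> norm f * norm (h x - h y)" by (rule lip0_bound)
  also have "\<dots> \<le> norm f * (norm h * norm (x - y))" by (intro mult_left_mono lip0_bound) simp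
  finally show "norm (lip0_compose f h x - lip0_compose f h y) \<le> norm f * norm h * norm (x - y)"
    by simp
qed simp

lemma lip_ideal_ball_compose_delta:
  fixes A :: "'u::banach set \<Rightarrow> 'u set \<Rightarrow> ('u \<Rightarrow> 'u) set" and J :: "'a::banach free \<Rightarrow> 'u"
    and f :: "('a free, 'b::banach) lip0"
  assumes A: "operator_ideal A" and J: "linear_isometry J" and f: "f \<in> lip_ideal_ball A lam"
  shows "lip0_compose f (lip_of_free id_blinfun) \<in> lip_ideal_ball A lam"
proof -
  have "norm (lip_of_free (id_blinfun :: 'a free \<Rightarrow>\<^sub>L 'a free)) \<le> 1"
    using norm_lip_of_free_le norm_blinfun_id_le by (rule order_trans)
  then have "norm f * norm (lip_of_free (id_blinfun :: 'a free \<Rightarrow>\<^sub>L 'a free)) \<le> norm f * 1"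
    by (intro mult_left_mono) auto
  then have "norm (lip0_compose f (lip_of_free id_blinfun)) \<le> lam"
    using norm_lip0_compose_le[of f "lip_of_free id_blinfun"] f by (simp add: lip_ideal_ball_def)
  moreover have "lip_lin (lip0_compose f (lip_of_free id_blinfun)) \<in> ideal_ops A"
    using f unfolding lip_lin_compose[of f] lip_ideal_ball_def lip_ideal_def
    by (intro ideal_ops_compose_right[OF A J]) auto
  ultimately show ?thesis by (simp add: lip_ideal_ball_def lip_ideal_def)
qed

lemma compact_free_delta_image: "compact K \<Longrightarrow> compact (free_delta ` K)"
proof (rule compact_continuous_image)
  show "continuous_on K free_delta"
    by (intro lipschitz_on_continuous_on[of 1] lipschitz_onI) (simp_all add: dist_norm norm_free_delta_diff)
qed

section \<open>Approximation of the barycentre map\<close>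

text \<open>
  If \<open>f\<close> is close to the identity at \<open>x\<close>, then \<open>lip_lin f\<close> is close to the barycentre map at
  \<open>free_delta x\<close>. The linearizations have norm at most \<open>lam\<close>, so that this pointwise convergence
  spreads to the whole free space and is uniform on compact sets.
\<close>
lemma id_approx_imp_beta_linear_approx:
  fixes A :: "'u::banach set \<Rightarrow> 'u set \<Rightarrow> ('u \<Rightarrow> 'u) set"
  assumes "lip_ideal_BAP TYPE('a::banach) A lam"
  shows "blinfun_apply (free_beta :: 'a free \<Rightarrow>\<^sub>L 'a) \<in> compact_open closure_of (blinfun_apply ` ideal_ball A lam)"
  unfolding in_closure_of_compact_open
proof (intro allI impI)
  fix K :: "'a free set" and e :: real assume K: "compact K" and e: "0 < e"
  have near: "\<exists>f \<in> lip_ideal_ball A lam. \<forall>x\<in>Q. dist (lip0_apply f x) (x :: 'a) < d" if "finite Q" "0 < d" for Q d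
    using assms that by (auto simp: lip_ideal_BAP_def in_closure_of_compact_open finite_imp_compact)
  obtain F where F: "F \<noteq> bot" "\<forall>\<^sub>F f in F. f \<in> (lip_ideal_ball A lam :: ('a, 'a) lip0 set)"
    "\<And>x. ((\<lambda>f. lip0_apply f x) \<longlongrightarrow> x) F"
    using pointwise_approximating_filter[OF near] by blast
  have bd: "\<forall>\<^sub>F f in F. norm (lip_lin f) \<le> lam"
    using F(2) by eventually_elim (simp add: lip_ideal_ball_def norm_lip_lin)
  have conv: "((\<lambda>f. lip_lin f m) \<longlongrightarrow> free_beta m) F" for m :: "'a free"
  proof (rule bounded_net_converges_on_closed_span[OF bd])
    show "((\<lambda>f. lip_lin f m) \<longlongrightarrow> free_beta m) F" if "m \<in> range free_delta" for m
      using that F(3) by auto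
  qed (simp add: closure_span_free_delta)
  have "\<forall>\<^sub>F f in F. f \<in> lip_ideal_ball A lam \<and> (\<forall>m\<in>K. dist (lip_lin f m) (free_beta m) < e)"
    using F(2) bounded_net_converges_uniformly_on_compact[OF bd conv K e] by eventually_elim simp
  then obtain f where "f \<in> lip_ideal_ball A lam" "\<forall>m\<in>K. dist (lip_lin f m) (free_beta m) < e"
    using eventually_happens'[OF F(1)] by blast
  then show "\<exists>g\<in>blinfun_apply ` ideal_ball A lam. \<forall>m\<in>K. dist (g m) (free_beta m) < e"
    by (intro bexI[of _ "blinfun_apply (lip_lin f)"])
      (auto simp: ideal_ball_def lip_ideal_ball_def lip_ideal_def norm_lip_lin)
qed

text \<open>
  An operator \<open>T\<close> in the ideal is itself a Lipschitz map with the same values, whose linearization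
  \<open>T o\<^sub>L free_beta\<close> again belongs to the ideal.
\<close>
lemma beta_linear_approx_imp_lip_approx:
  fixes A :: "'u::banach set \<Rightarrow> 'u set \<Rightarrow> ('u \<Rightarrow> 'u) set" and J :: "'a::banach free free \<Rightarrow> 'u"
  assumes A: "operator_ideal A" and J: "linear_isometry J"
    and approx: "blinfun_apply (free_beta :: 'a free \<Rightarrow>\<^sub>L 'a) \<in> compact_open closure_of (blinfun_apply ` ideal_ball A lam)"
  shows "blinfun_apply (free_beta :: 'a free \<Rightarrow>\<^sub>L 'a) \<in> compact_open closure_of (lip0_apply ` lip_ideal_ball A lam)"
proof -
  have "lip_of_blinfun T \<in> lip_ideal_ball A lam" if "T \<in> ideal_ball A lam" for T :: "'a free \<Rightarrow>\<^sub>L 'a"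
    using that norm_lip_of_blinfun_le[of T] ideal_ops_compose_right[OF A J, of T free_beta]
    by (auto simp: lip_ideal_ball_def lip_ideal_def ideal_ball_def lip_lin_lip_of_blinfun)
  moreover have "blinfun_apply T = lip0_apply (lip_of_blinfun T)" for T :: "'a free \<Rightarrow>\<^sub>L 'a"
    by (rule ext) simp
  ultimately have "blinfun_apply ` ideal_ball A lam \<subseteq>
      (lip0_apply ` lip_ideal_ball A lam :: ('a free \<Rightarrow> 'a) set)" by auto
  then show ?thesis using approx closure_of_mono by blast
qed

text \<open>
  Compose with the isometry \<open>free_delta\<close>: it turns the barycentre map into the identity and maps
  compact sets to compact sets.
\<close>
lemma beta_lip_approx_imp_id_approx:
  fixes A :: "'u::banach set \<Rightarrow> 'u set \<Rightarrow> ('u \<Rightarrow> 'u) set" and J :: "'a::banach free \<Rightarrow> 'u"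
  assumes A: "operator_ideal A" and J: "linear_isometry J"
    and approx: "blinfun_apply (free_beta :: 'a free \<Rightarrow>\<^sub>L 'a) \<in> compact_open closure_of (lip0_apply ` lip_ideal_ball A lam)"
  shows "lip_ideal_BAP TYPE('a) A lam"
  unfolding lip_ideal_BAP_def in_closure_of_compact_open
proof (intro allI impI)
  fix K :: "'a set" and e :: real assume K: "compact K" and e: "0 < e"
  obtain f :: "('a free, 'a) lip0" where f: "f \<in> lip_ideal_ball A lam"
    "\<forall>m\<in>free_delta ` K. dist (lip0_apply f m) (free_beta m) < e"
    using approx compact_free_delta_image[OF K] e unfolding in_closure_of_compact_open by blast
  show "\<exists>g\<in>lip0_apply ` lip_ideal_ball A lam. \<forall>x\<in>K. dist (g x) (id x) < e"
    using lip_ideal_ball_compose_delta[OF A J f(1)] f(2)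
    by (intro bexI[of _ "lip0_apply (lip0_compose f (lip_of_free id_blinfun))"]) auto
qed

text \<open>
  The adjoint of \<open>T\<close>, with the dual of the free space read as a space of Lipschitz functions.
\<close>
definition lip_adjoint :: "('a::banach free \<Rightarrow>\<^sub>L 'a) \<Rightarrow> ('a \<Rightarrow>\<^sub>L real) \<Rightarrow>\<^sub>L ('a, real) lip0" where
  "lip_adjoint T = free_dual_iso o\<^sub>L blinfun_adjoint T"

lemma lip_adjoint_ball_eq: "lip_adjoint_ball A lam = lip_adjoint ` ideal_ball A lam"
  by (auto simp: lip_adjoint_ball_def ideal_adjoint_ball_def lip_adjoint_def image_image)

lemma lip_adjoint_beta: "lip_adjoint free_beta = lip_embed_dual"
  by (simp add: lip_adjoint_def lip_embed_dual_eq_adjoint)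

lemma lip_dual_functional_lip_adjoint:
  "lip_dual_functional (lip_adjoint T) (ptensor_prod \<phi> m) = \<phi> (T m)"
  by (simp add: lip_dual_functional_prod lip_adjoint_def free_rep_lip_lin blinfun_adjoint.rep_eq)

lemma norm_lip_adjoint_le: "norm (lip_adjoint T) \<le> norm T"
proof (rule norm_blinfun_bound)
  show "norm (lip_adjoint T \<phi>) \<le> norm T * norm \<phi>" for \<phi>
    using norm_blinfun_compose[of \<phi> T]
    by (simp add: lip_adjoint_def norm_free_dual_iso blinfun_adjoint.rep_eq mult.commute)
qed simp

text \<open>
  On the elementary tensors \<open>\<phi> \<otimes> m\<close> the functional of \<open>lip_adjoint T\<close> is \<open>\<phi> (T m)\<close>, which converges
  when \<open>T\<close> converges pointwise. The bound \<open>lam\<close> extends this to the completed tensor product.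
\<close>
lemma beta_linear_approx_imp_weak_star_approx:
  fixes A :: "'u::banach set \<Rightarrow> 'u set \<Rightarrow> ('u \<Rightarrow> 'u) set"
  assumes approx: "blinfun_apply (free_beta :: 'a::banach free \<Rightarrow>\<^sub>L 'a) \<in>
      compact_open closure_of (blinfun_apply ` ideal_ball A lam)"
  shows "(lip_embed_dual :: ('a \<Rightarrow>\<^sub>L real) \<Rightarrow>\<^sub>L ('a, real) lip0) \<in> lip_dual_weak_star closure_of lip_adjoint_ball A lam"
proof -
  let ?ball = "ideal_ball A lam :: ('a free \<Rightarrow>\<^sub>L 'a) set"
  have near: "\<exists>T\<in>?ball. \<forall>m\<in>Q. dist (blinfun_apply T m) (free_beta m) < d" if "finite Q" "0 < d" for Q d
    using approx that by (auto simp: in_closure_of_compact_open finite_imp_compact)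
  obtain F where F: "F \<noteq> bot" "\<forall>\<^sub>F T in F. T \<in> ?ball"
    "\<And>m. ((\<lambda>T. blinfun_apply T m) \<longlongrightarrow> free_beta m) F"
    using pointwise_approximating_filter[OF near] by blast
  have bd: "\<forall>\<^sub>F T in F. norm (lip_dual_functional (lip_adjoint T)) \<le> lam"
    using F(2)
  proof eventually_elim
    case (elim T)
    then show ?case
      using norm_lip_dual_functional_le[of "lip_adjoint T"] norm_lip_adjoint_le[of T]
      by (simp add: ideal_ball_def)
  qed
  have "((\<lambda>T. lip_dual_functional (lip_adjoint T) u) \<longlongrightarrow> lip_dual_functional lip_embed_dual u) F" for u
  proof (rule bounded_net_converges_on_closed_span[OF bd])
    fix v :: "('a \<Rightarrow>\<^sub>L real, 'a free) ptensor" assume "v \<in> range (\<lambda>(x, y). ptensor_prod x y)"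
    then obtain \<phi> m where v: "v = ptensor_prod \<phi> m" by auto
    have "((\<lambda>T. blinfun_apply \<phi> (blinfun_apply T m)) \<longlongrightarrow> \<phi> (free_beta m)) F"
      by (intro tendsto_intros F)
    then show "((\<lambda>T. lip_dual_functional (lip_adjoint T) v) \<longlongrightarrow> lip_dual_functional lip_embed_dual v) F"
      by (simp add: v lip_dual_functional_lip_adjoint flip: lip_adjoint_beta)
  qed (simp add: closure_span_ptensor_prod)
  moreover have "\<forall>\<^sub>F T in F. lip_adjoint T \<in> lip_adjoint_ball A lam"
    using F(2) by eventually_elim (simp add: lip_adjoint_ball_eq)
  ultimately show ?thesis using F(1) by (intro lip_dual_weak_star_closure_filterI)
qed

text \<open>
  Finite sums of elementary tensors \<open>\<psi> m \<otimes> m\<close> turn weak-star approximation of the embedding into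
  approximation of the barycentre map in the weak operator topology. The ball of the ideal is
  convex, so that the approximation also holds in the strong operator topology, and by boundedness
  uniformly on compact sets.
\<close>
lemma weak_star_approx_imp_beta_linear_approx:
  fixes A :: "'u::banach set \<Rightarrow> 'u set \<Rightarrow> ('u \<Rightarrow> 'u) set"
    and J :: "'a::banach free \<Rightarrow> 'u" and K :: "'a \<Rightarrow> 'u"
  assumes A: "operator_ideal A" and J: "linear_isometry J" and K: "linear_isometry K"
    and approx: "(lip_embed_dual :: ('a \<Rightarrow>\<^sub>L real) \<Rightarrow>\<^sub>L ('a, real) lip0) \<in> lip_dual_weak_star closure_of lip_adjoint_ball A lam"
  shows "blinfun_apply (free_beta :: 'a free \<Rightarrow>\<^sub>L 'a) \<in> compact_open closure_of (blinfun_apply ` ideal_ball A lam)"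
  unfolding in_closure_of_compact_open
proof (intro allI impI)
  fix C :: "'a free set" and e :: real assume C: "compact C" and e: "0 < e"
  let ?ball = "ideal_ball A lam :: ('a free \<Rightarrow>\<^sub>L 'a) set"
  have "\<exists>T\<in>?ball. \<bar>\<Sum>m\<in>Q. blinfun_apply (\<psi> m) (T m - free_beta m)\<bar> < d"
    if d: "0 < d" for \<psi> :: "'a free \<Rightarrow> 'a \<Rightarrow>\<^sub>L real" and Q d
  proof -
    define u where "u = (\<Sum>m\<in>Q. ptensor_prod (\<psi> m) m)"
    have u: "lip_dual_functional (lip_adjoint T) u = (\<Sum>m\<in>Q. \<psi> m (T m))" for T :: "'a free \<Rightarrow>\<^sub>L 'a"
      by (simp add: u_def blinfun.sum_right lip_dual_functional_lip_adjoint)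
    obtain R where "R \<in> lip_adjoint_ball A lam"
      "dist (lip_dual_functional lip_embed_dual u) (lip_dual_functional R u) < d"
      using lip_dual_weak_star_closure_approx[OF approx d] by blast
    then obtain T where "T \<in> ?ball" "dist (lip_dual_functional (lip_adjoint free_beta) u)
        (lip_dual_functional (lip_adjoint T) u) < d"
      by (auto simp: lip_adjoint_ball_eq lip_adjoint_beta)
    then show ?thesis
      by (intro bexI[of _ T]) (simp_all add: u dist_real_def blinfun.diff_right sum_subtractf abs_minus_commute)
  qed
  then have near: "\<exists>T\<in>?ball. \<forall>m\<in>Q. dist (blinfun_apply T m) (free_beta m) < d" if "finite Q" "0 < d" for Q d
    using that by (intro convex_weak_approximation_imp_strong convex_ideal_ball[OF A J K])
  obtain F where F: "F \<noteq> bot" "\<forall>\<^sub>F T in F. T \<in> ?ball"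
    "\<And>m. ((\<lambda>T. blinfun_apply T m) \<longlongrightarrow> free_beta m) F"
    using pointwise_approximating_filter[OF near] by blast
  have bd: "\<forall>\<^sub>F T in F. norm T \<le> lam"
    using F(2) by eventually_elim (simp add: ideal_ball_def)
  have "\<forall>\<^sub>F T in F. T \<in> ?ball \<and> (\<forall>m\<in>C. dist (T m) (free_beta m) < e)"
    using F(2) bounded_net_converges_uniformly_on_compact[OF bd F(3) C e] by eventually_elim simp
  then show "\<exists>g\<in>blinfun_apply ` ?ball. \<forall>m\<in>C. dist (g m) (free_beta m) < e"
    using eventually_happens'[OF F(1)] by blast
qed

section \<open>The equivalence\<close>

theorem theorem3p1:
  fixes A :: "'u::banach set \<Rightarrow> 'u set \<Rightarrow> ('u \<Rightarrow> 'u) set"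
    and lam :: real
  assumes "operator_ideal A"
    and "lam \<ge> 1"
    and "\<exists>J :: 'a::banach \<Rightarrow> 'u. linear_isometry J"
    and "\<exists>J :: 'a free \<Rightarrow> 'u. linear_isometry J"
    and "\<exists>J :: 'a free free \<Rightarrow> 'u. linear_isometry J"
  shows "(lip_ideal_BAP TYPE('a) A lam \<longleftrightarrow>
            blinfun_apply (free_beta :: 'a free \<Rightarrow>\<^sub>L 'a) \<in>
              compact_open closure_of (lip0_apply ` lip_ideal_ball A lam))
       \<and> (blinfun_apply (free_beta :: 'a free \<Rightarrow>\<^sub>L 'a) \<in>
              compact_open closure_of (lip0_apply ` lip_ideal_ball A lam) \<longleftrightarrow>
          blinfun_apply (free_beta :: 'a free \<Rightarrow>\<^sub>L 'a) \<in>
              compact_open closure_of (blinfun_apply ` ideal_ball A lam))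
       \<and> (blinfun_apply (free_beta :: 'a free \<Rightarrow>\<^sub>L 'a) \<in>
              compact_open closure_of (blinfun_apply ` ideal_ball A lam) \<longleftrightarrow>
          (lip_embed_dual :: ('a \<Rightarrow>\<^sub>L real) \<Rightarrow>\<^sub>L ('a, real) lip0) \<in>
              lip_dual_weak_star closure_of lip_adjoint_ball A lam)"
proof -
  obtain J0 :: "'a \<Rightarrow> 'u" where J0: "linear_isometry J0" using assms(3) by blast
  obtain J1 :: "'a free \<Rightarrow> 'u" where J1: "linear_isometry J1" using assms(4) by blast
  obtain J2 :: "'a free free \<Rightarrow> 'u" where J2: "linear_isometry J2" using assms(5) by blast
  note ac = id_approx_imp_beta_linear_approx[where ?'a = 'a, of A lam]
  note cb = beta_linear_approx_imp_lip_approx[OF assms(1) J2, of lam]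
  note ba = beta_lip_approx_imp_id_approx[OF assms(1) J1, of lam]
  note cd = beta_linear_approx_imp_weak_star_approx[where ?'a = 'a, of A lam]
  note dc = weak_star_approx_imp_beta_linear_approx[OF assms(1) J1 J0, of lam]
  show ?thesis using ac cb ba cd dc by blast
qed

end
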